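(* There exist absolute constants $C,c,d>0$ such that the following holds. Let $\mathcal I$ be a Unique Games instance on $V=[n]$ with alphabet $[k]$ and regular constraint graph $G$, let $\epsilon>0$ and $r\ge C\,k\cdot\mathrm{rank}_{\ge c\epsilon^4}(G)/\epsilon^{d}$. Suppose the $r$-round Lasserre value of $\mathcal I$ is $\sigma$. Then, given an optimal $r$-round Lasserre solution, Propagation Sampling outputs an assignment whose expected value for $\mathcal I$ is at least $\sigma-\epsilon$.
   Context: A Unique Games instance is a probability distribution over triples $(i,j,\pi)$ with $i,j\in V$ and $\pi$ a permutation of $[k]$; the value of $x\in[k]^V$ is $\Pr_{(i,j,\pi)\sim\mathcal I}[x_j=\pi(x_i)]$. The constraint graph (weight of $\{i,j\}$ = probability mass of constraints on $i,j$) is regular and identified with its normalized adjacency matrix; $\mathrm{rank}_{\ge\tau}(G)$ is the number of its eigenvalues larger than $\tau$. An $r$-round Lasserre solution: consistent distributions $\mu_T$ on $[k]^T$ for all $T\subseteq V$, $|T|\le r+2$ (local random variables $X_1,\dots,X_n$), and vectors $v_{S,\alpha}$ with $\langle v_{S,\alpha},v_{T,\beta}\rangle=\Pr[X_S=\alpha,X_T=\beta]$ whenever $|S\cup T|\le r+2$; its value is $\mathbb E_{(i,j,\pi)\sim\mathcal I}\Pr[X_j=\pi(X_i)]$, and the Lasserre value is the maximum. Propagation Sampling: choose $m\in\{1,\dots,r\}$ uniformly; choose $S\in V^m$ uniformly (repetitions allowed); sample $x_S\sim\mu_S$; for every $i\in V\setminus S$ independently sample $x_i$ from $\mu_{S\cup\{i\}}$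 conditioned on $X_S=x_S$; output $x$. *)

theory Defs
  imports
    "HOL-Probability.Probability"
    "HOL-Probability.Product_PMF"
    "HOL-Library.Monad_Syntax"
    "Jordan_Normal_Form.Char_Poly"
begin

type_synonym ug = "(nat \<times> nat \<times> (nat \<Rightarrow> nat)) pmf"

text \<open>Vertices are \<open>V = {..<n}\<close> and the alphabet \<open>[k]\<close> is \<open>{..<k}\<close>. A labelling of a set \<open>T\<close> of
  vertices, i.e. an element of \<open>[k]^T\<close>, is an element of \<open>T \<rightarrow>\<^sub>E {..<k}\<close>.\<close>

definition ug_instance :: "nat \<Rightarrow> nat \<Rightarrow> ug \<Rightarrow> bool" where
  "ug_instance n k I \<longleftrightarrow>
     (\<forall>(i, j, \<pi>) \<in> set_pmf I. i < n \<and> j < n \<and> \<pi> permutes {..<k})"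

definition ug_value :: "ug \<Rightarrow> (nat \<Rightarrow> nat) \<Rightarrow> real" where
  "ug_value I x = measure_pmf.prob I {(i, j, \<pi>). x j = \<pi> (x i)}"


subsection \<open>The constraint graph\<close>

definition edge_weight :: "ug \<Rightarrow> nat \<Rightarrow> nat \<Rightarrow> real" where
  "edge_weight I i j = measure_pmf.prob I {(a, b, \<pi>). {a, b} = {i, j}}"

definition weighted_degree :: "nat \<Rightarrow> ug \<Rightarrow> nat \<Rightarrow> real" where
  "weighted_degree n I i = (\<Sum>j<n. edge_weight I i j)"

definition regular_constraint_graph :: "nat \<Rightarrow> ug \<Rightarrow> bool" where
  "regular_constraint_graph n I \<longleftrightarrow> (\<exists>D. \<forall>i<n. weighted_degree n I i = D)"

definition normalized_adjacency :: "nat \<Rightarrow> ug \<Rightarrow> real Matrix.mat" where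
  "normalized_adjacency n I =
     Matrix.mat n n (\<lambda>(i, j). edge_weight I i j / weighted_degree n I i)"

text \<open>The threshold rank counts eigenvalues with multiplicity, and the inequality is strict.\<close>

definition threshold_rank :: "real \<Rightarrow> real Matrix.mat \<Rightarrow> nat" where
  "threshold_rank \<tau> A = size {#x \<in># proots (char_poly A). x > \<tau>#}"


subsection \<open>Lasserre solutions\<close>

type_synonym local_dists = "nat set \<Rightarrow> (nat \<Rightarrow> nat) pmf"
type_synonym lasserre_vectors = "nat set \<Rightarrow> (nat \<Rightarrow> nat) \<Rightarrow> real Matrix.vec"

definition local_distributions :: "nat \<Rightarrow> nat \<Rightarrow> nat \<Rightarrow> local_dists \<Rightarrow> bool" where
  "local_distributions n k l \<mu> \<longleftrightarrow>
     (\<forall>T. T \<subseteq> {..<n} \<and> card T \<le> l \<longrightarrow> set_pmf (\<mu> T) \<subseteq> T \<rightarrow>\<^sub>E {..<k}) \<and>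
     (\<forall>S T. S \<subseteq> {..<n} \<and> card S \<le> l \<and> T \<subseteq> {..<n} \<and> card T \<le> l \<longrightarrow>
        map_pmf (\<lambda>x. restrict x (S \<inter> T)) (\<mu> S) = map_pmf (\<lambda>x. restrict x (S \<inter> T)) (\<mu> T))"

definition joint_prob ::
  "local_dists \<Rightarrow> nat set \<Rightarrow> (nat \<Rightarrow> nat) \<Rightarrow> nat set \<Rightarrow> (nat \<Rightarrow> nat) \<Rightarrow> real" where
  "joint_prob \<mu> S \<alpha> T \<beta> =
     measure_pmf.prob (\<mu> (S \<union> T)) {x. restrict x S = \<alpha> \<and> restrict x T = \<beta>}"

text \<open>The dimension \<open>N\<close> of the space containing the vectors is not bounded; as there are only
  finitely many vectors, finite-dimensional spaces lose no generality.\<close>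

definition lasserre_solution ::
  "nat \<Rightarrow> nat \<Rightarrow> nat \<Rightarrow> local_dists \<Rightarrow> lasserre_vectors \<Rightarrow> bool" where
  "lasserre_solution n k r \<mu> v \<longleftrightarrow>
     local_distributions n k (r + 2) \<mu> \<and>
     (\<exists>N. \<forall>S \<alpha>. v S \<alpha> \<in> carrier_vec N) \<and>
     (\<forall>S T. S \<subseteq> {..<n} \<and> T \<subseteq> {..<n} \<and> card (S \<union> T) \<le> r + 2 \<longrightarrow>
        (\<forall>\<alpha> \<in> S \<rightarrow>\<^sub>E {..<k}. \<forall>\<beta> \<in> T \<rightarrow>\<^sub>E {..<k}.
           scalar_prod (v S \<alpha>) (v T \<beta>) = joint_prob \<mu> S \<alpha> T \<beta>))"

definition lasserre_objective :: "ug \<Rightarrow> local_dists \<Rightarrow> real" where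
  "lasserre_objective I \<mu> =
     measure_pmf.expectation I
       (\<lambda>(i, j, \<pi>). measure_pmf.prob (\<mu> {i, j}) {x. x j = \<pi> (x i)})"

definition lasserre_value :: "nat \<Rightarrow> nat \<Rightarrow> nat \<Rightarrow> ug \<Rightarrow> real" where
  "lasserre_value n k r I = Sup {lasserre_objective I \<mu> | \<mu> v. lasserre_solution n k r \<mu> v}"

definition optimal_lasserre_solution ::
  "nat \<Rightarrow> nat \<Rightarrow> nat \<Rightarrow> ug \<Rightarrow> local_dists \<Rightarrow> lasserre_vectors \<Rightarrow> bool" where
  "optimal_lasserre_solution n k r I \<mu> v \<longleftrightarrow>
     lasserre_solution n k r \<mu> v \<and>
     (\<forall>\<mu>' v'. lasserre_solution n k r \<mu>' v' \<longrightarrow> lasserre_objective I \<mu>' \<le> lasserre_objective I \<mu>)"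


subsection \<open>Propagation Sampling\<close>

text \<open>The seed is an \<open>m\<close>-tuple of vertices, so it may contain repetitions. For \<open>r = 0\<close> there is no
  admissible \<open>m\<close> and \<open>pmf_of_set {}\<close> is an unspecified distribution.\<close>

definition propagation_sampling :: "nat \<Rightarrow> nat \<Rightarrow> local_dists \<Rightarrow> (nat \<Rightarrow> nat) pmf" where
  "propagation_sampling n r \<mu> =
     do {
       m \<leftarrow> pmf_of_set {1..r};
       s \<leftarrow> pmf_of_set {s. set s \<subseteq> {..<n} \<and> length s = m};
       let S = set s;
       a \<leftarrow> \<mu> S;
       b \<leftarrow> Pi_pmf ({..<n} - S) undefined
              (\<lambda>i. map_pmf (\<lambda>x. x i)
                     (cond_pmf (\<mu> (insert i S)) {x. restrict x S = a}));
       return_pmf (\<lambda>i. if i \<in> S then a i else b i)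
     }"

end

theory Submission
  imports Defs "Jordan_Normal_Form.Spectral_Radius"
begin

text \<open>Condition on \<open>X\<^sub>S = x\<close>. On a constraint \<open>(i, j, \<pi>)\<close>, sampling \<open>X\<^sub>i\<close> and \<open>X\<^sub>j\<close> independently
  loses the sum over \<open>a\<close> of the covariances of the events \<open>X\<^sub>i = a\<close> and \<open>X\<^sub>j = \<pi> a\<close>. By
  Cauchy-Schwarz the square of this loss is at most the permutation-invariant correlation
  \<open>\<Sum>a b. cov(i a, j b)\<^sup>2 / sqrt (P(i a) * P(j b))\<close>, which is a Gram matrix in \<open>i, j\<close> because the
  covariances are inner products of centred Lasserre vectors. Hence its average over the edges
  exceeds \<open>O(\<tau>)\<close> only if its average over all pairs is large in comparison with one over the
  threshold rank. By AM-GM the correlation of a pair is at most the symmetrized decrease of variance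
  caused by conditioning on one end. The variance is bounded, so over the choices of the seed size
  the decreases telescope and their average is at most \<open>1 / r\<close>.\<close>

section \<open>The spectral theorem and the threshold rank\<close>

unbundle no vec_syntax
unbundle no inner_syntax

text \<open>The obstacle is that the loss on a constraint depends on its permutation, while the
  threshold rank only concerns a matrix indexed by vertices. Summing squared covariances over all
  label pairs removes the permutation. The weight then has three jobs: it must factor between the
  two ends, for the Gram matrix; the weights of the matched labels \<open>(a, \<pi> a)\<close> must
  sum to at most 1, for Cauchy-Schwarz; and its reciprocal must be comparable with
  \<open>1 / P(j b)\<close>, for the decrease of variance. The geometric mean of the two
  probabilities does all three. As the correlations lie in [0, 1], the sum of their squares is at
  most their plain sum, so conditioning has to control nothing but an average over pairs. For each
  seed, with \<open>R\<close> the threshold rank and \<open>g\<close> the average gain over pairs,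
  this yields \<open>loss^2 \<le> 2 * \<tau> + 2 * sqrt (R * g)\<close>. Jensen, once for the square
  and once for the root, averages it over the seeds; the root is the reason for \<open>r\<close> of
  order \<open>R / \<epsilon>^4\<close>.\<close>

text \<open>The complex spectrum is non-empty. By symmetry the form \<open>Q\<close> at a complex
  eigenvector equals its own conjugate, so the eigenvalue is real; it is then a root of the real
  characteristic polynomial, which supplies a real eigenvector.\<close>

lemma symmetric_mat_eigenvector:
  fixes A :: "real Matrix.mat"
  assumes A: "A \<in> carrier_mat n n" and sym: "transpose_mat A = A" and n: "n > 0"
  shows "\<exists>x e. x \<in> carrier_vec n \<and> x \<noteq> 0\<^sub>v n \<and> A *\<^sub>v x = e \<cdot>\<^sub>v x"
proof -
  define C where "C = map_mat complex_of_real A"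
  have C: "C \<in> carrier_mat n n" using A by (simp add: C_def)
  from spectrum_non_empty[OF C] n obtain z where z: "eigenvalue C z"
    by (auto simp: spectrum_def)
  then obtain y where y: "y \<in> carrier_vec n" "y \<noteq> 0\<^sub>v n" "C *\<^sub>v y = z \<cdot>\<^sub>v y"
    using C by (auto simp: eigenvalue_def eigenvector_def)
  have sym': "A $$ (i, j) = A $$ (j, i)" if "i < n" "j < n" for i j
    using sym A that by (metis carrier_matD index_transpose_mat(1))
  have row: "(\<Sum>j<n. complex_of_real (A $$ (i, j)) * y $ j) = z * y $ i" if "i < n" for i
  proof -
    have "(C *\<^sub>v y) $ i = z * y $ i" using y that by simp
    moreover have "(C *\<^sub>v y) $ i = (\<Sum>j<n. complex_of_real (A $$ (i, j)) * y $ j)"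
      using that A y(1) by (simp add: C_def scalar_prod_def atLeast0LessThan)
    ultimately show ?thesis by simp
  qed
  define Q where "Q = (\<Sum>i<n. \<Sum>j<n. complex_of_real (A $$ (i, j)) * y $ j * cnj (y $ i))"
  define M where "M = (\<Sum>i<n. (cmod (y $ i))\<^sup>2)"
  have "Q = (\<Sum>i<n. z * (y $ i * cnj (y $ i)))"
    unfolding Q_def by (intro sum.cong refl) (simp add: row flip: sum_distrib_right mult.assoc)
  also have "\<dots> = z * of_real M"
    by (simp only: sum_distrib_left M_def of_real_sum complex_norm_square)
  finally have Q: "Q = z * of_real M" .
  have "cnj Q = (\<Sum>i<n. \<Sum>j<n. complex_of_real (A $$ (i, j)) * cnj (y $ j) * y $ i)"
    by (simp add: Q_def)
  also have "\<dots> = (\<Sum>j<n. \<Sum>i<n. complex_of_real (A $$ (i, j)) * cnj (y $ j) * y $ i)"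
    by (rule sum.swap)
  also have "\<dots> = Q"
    unfolding Q_def by (intro sum.cong refl) (simp add: sym' mult_ac)
  finally have "cnj z * of_real M = z * of_real M" using Q by simp
  moreover have "M \<noteq> 0"
  proof
    assume "M = 0"
    then have "\<forall>i<n. y $ i = 0" unfolding M_def by (subst (asm) sum_nonneg_eq_0_iff) auto
    then have "y = 0\<^sub>v n" using y(1) by (intro eq_vecI) auto
    with y(2) show False by simp
  qed
  ultimately have "cnj z = z" by simp
  then have zr: "z = of_real (Re z)"
    by (metis complex_cnj_cancel_iff complex_is_Real_iff Reals_cnj_iff of_real_Re)
  have "poly (char_poly C) z = 0" using z C by (simp add: eigenvalue_root_char_poly)
  then have "poly (map_poly complex_of_real (char_poly A)) (of_real (Re z)) = 0"
    unfolding C_def using A zr by (simp add: of_real_hom.char_poly_hom)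
  then have "poly (char_poly A) (Re z) = 0" by simp
  then have "eigenvalue A (Re z)" using A by (simp add: eigenvalue_root_char_poly)
  then show ?thesis using A by (auto simp: eigenvalue_def eigenvector_def)
qed

text \<open>\<open>H\<close> is the reflection \<open>1 - 2 v v^T / |v|^2\<close> with
  \<open>v = x - e_0\<close>, which exchanges the unit vectors \<open>e_0\<close> and
  \<open>x\<close>. For \<open>x = e_0\<close> it degenerates, hence the separate case.\<close>

lemma householder_reflection:
  fixes x :: "real Matrix.vec"
  assumes x: "x \<in> carrier_vec n" and n: "n > 0" and norm: "x \<bullet> x = 1"
  shows "\<exists>H. H \<in> carrier_mat n n \<and> transpose_mat H = H \<and> H * H = 1\<^sub>m n \<and> col H 0 = x"
proof (cases "x = unit_vec n 0")
  case True
  then show ?thesis using n by (intro exI[of _ "1\<^sub>m n"]) auto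
next
  case False
  define v where "v i = x $ i - (if i = 0 then 1 else 0)" for i
  define c where "c = (\<Sum>i<n. v i * v i)"
  have xx: "(\<Sum>i<n. x $ i * x $ i) = 1"
    using norm x by (simp add: scalar_prod_def atLeast0LessThan)
  have "c = (\<Sum>i<n. x $ i * x $ i - 2 * (if i = 0 then x $ i else 0) + (if i = 0 then 1 else 0))"
    unfolding c_def v_def by (intro sum.cong) (auto simp: algebra_simps)
  also have "\<dots> = 1 - 2 * x $ 0 + 1"
    using n by (simp add: sum.distrib sum_subtractf xx sum_distrib_left[symmetric])
  \<comment> \<open>Here \<open>c = |v|^2 = 2 - 2 x_0\<close>, as \<open>x\<close> is a unit vector.
    So \<open>2 v_0 / c = -1\<close>, and column 0 of \<open>H\<close> is
    \<open>e_0 + v = x\<close>.\<close>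
  finally have c: "v 0 = - c / 2" by (simp add: v_def)
  then have x_0: "x $ 0 = 1 - c / 2" by (simp add: v_def)
  have "c \<noteq> 0"
  proof
    assume "c = 0"
    then have "\<forall>i<n. v i = 0" unfolding c_def by (subst (asm) sum_nonneg_eq_0_iff) auto
    then have "x = unit_vec n 0" using x by (intro eq_vecI) (auto simp: v_def)
    with False show False by simp
  qed
  define H where "H = Matrix.mat n n (\<lambda>(i, j). (if i = j then 1 else 0) - 2 / c * (v i * v j))"
  have H: "H \<in> carrier_mat n n" by (simp add: H_def)
  have "H * H = 1\<^sub>m n"
  proof (rule eq_matI)
    fix i j assume ij: "i < dim_row (1\<^sub>m n :: real Matrix.mat)" "j < dim_col (1\<^sub>m n :: real Matrix.mat)"
    then have "(H * H) $$ (i, j) = (\<Sum>l<n. H $$ (i, l) * H $$ (l, j))"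
      using H by (simp add: times_mat_def scalar_prod_def atLeast0LessThan)
    also have "\<dots> = (\<Sum>l<n. (if l = i then (if i = j then 1 else 0) - 2 / c * (v i * v j) else 0)
         - (if l = j then 2 / c * (v i * v j) else 0) + (4 / c\<^sup>2 * (v i * v j)) * (v l * v l))"
      using ij by (intro sum.cong) (auto simp: H_def algebra_simps power2_eq_square)
    also have "\<dots> = (if i = j then 1 else 0) - 4 / c * (v i * v j) + 4 / c\<^sup>2 * (v i * v j) * c"
    proof -
      have "(\<Sum>l<n. (4 / c\<^sup>2 * (v i * v j)) * (v l * v l)) = 4 / c\<^sup>2 * (v i * v j) * c"
        by (simp only: c_def sum_distrib_left)
      then show ?thesis using ij by (simp only: sum.distrib sum_subtractf) simp
    qed
    also have "\<dots> = (if i = j then 1 else 0)"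
      using \<open>c \<noteq> 0\<close> by (simp add: field_simps power2_eq_square)
    finally show "(H * H) $$ (i, j) = (1\<^sub>m n) $$ (i, j)" using ij by simp
  qed (use H in auto)
  moreover have "transpose_mat H = H"
    by (intro eq_matI) (auto simp: H_def)
  moreover have "col H 0 = x"
    using x n \<open>c \<noteq> 0\<close> by (intro eq_vecI) (auto simp: H_def c x_0, auto simp: v_def)
  ultimately show ?thesis using H by blast
qed

lemma mat_diag_Suc:
  "mat_diag (Suc m) (case_nat e d) =
    four_block_mat (mat_diag 1 (\<lambda>_. e)) (0\<^sub>m 1 m) (0\<^sub>m m 1) (mat_diag m d)"
  by (intro eq_matI) (auto simp: mat_diag_def split: nat.splits)

text \<open>Deflation: with \<open>H\<close> taking \<open>e_0\<close> to a unit eigenvector, the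
  first column of \<open>H A H\<close> is a multiple of \<open>e_0\<close>, by symmetry so is the
  first row, and a smaller symmetric block is left for the induction.\<close>

lemma symmetric_mat_diagonalization:
  fixes A :: "real Matrix.mat"
  assumes "A \<in> carrier_mat n n" and "transpose_mat A = A"
  shows "\<exists>U d. U \<in> carrier_mat n n \<and> transpose_mat U * U = 1\<^sub>m n \<and>
    A = U * mat_diag n d * transpose_mat U"
  using assms
proof (induction n arbitrary: A)
  case 0
  then show ?case by (intro exI[of _ "1\<^sub>m 0"] exI[of _ "\<lambda>_. 0"]) auto
next
  case (Suc m)
  let ?n = "Suc m"
  have A: "A \<in> carrier_mat ?n ?n" by fact
  obtain x0 e where x0: "x0 \<in> carrier_vec ?n" "x0 \<noteq> 0\<^sub>v ?n" "A *\<^sub>v x0 = e \<cdot>\<^sub>v x0"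
    using symmetric_mat_eigenvector[OF Suc.prems] by auto
  define s where "s = x0 \<bullet> x0"
  have s_eq: "s = (\<Sum>i<?n. x0 $ i * x0 $ i)"
    using x0(1) by (simp add: s_def scalar_prod_def atLeast0LessThan del: sum.lessThan_Suc)
  have "s \<noteq> 0"
  proof
    assume "s = 0"
    then have "\<forall>i<?n. x0 $ i = 0" unfolding s_eq by (subst (asm) sum_nonneg_eq_0_iff) auto
    then have "x0 = 0\<^sub>v ?n" using x0(1) by (intro eq_vecI) auto
    with x0(2) show False by simp
  qed
  moreover have "s \<ge> 0" unfolding s_eq by (rule sum_nonneg) simp
  ultimately have s: "s > 0" by simp
  define x where "x = (1 / sqrt s) \<cdot>\<^sub>v x0"
  have x: "x \<in> carrier_vec ?n" using x0 by (simp add: x_def)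
  have xx: "x \<bullet> x = 1"
    using x0 s by (simp add: x_def s_def[symmetric] field_simps)
  have Ax: "A *\<^sub>v x = e \<cdot>\<^sub>v x"
    using x0 A by (simp add: x_def mult_mat_vec smult_smult_assoc mult.commute)
  obtain H where H: "H \<in> carrier_mat ?n ?n" "transpose_mat H = H" "H * H = 1\<^sub>m ?n" "col H 0 = x"
    using householder_reflection[OF x _ xx] by auto
  define B where "B = H * A * H"
  have B: "B \<in> carrier_mat ?n ?n" using H A by (simp add: B_def)
  have Bsym: "transpose_mat B = B"
    using H(1,2) A Suc.prems(2) unfolding B_def
    by (subst transpose_mult[of _ ?n ?n _ ?n], simp, simp, subst transpose_mult[of _ ?n ?n _ ?n])
      (simp_all add: assoc_mult_mat[of _ ?n ?n _ ?n _ ?n])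
  have "H *\<^sub>v x = col (H * H) 0" using col_mult2[OF H(1) H(1), of 0] H(4) by simp
  then have Hx: "H *\<^sub>v x = unit_vec ?n 0" unfolding H(3) by simp
  have "col B 0 = (H * A) *\<^sub>v x"
    unfolding B_def H(4)[symmetric] using H(1) A by (intro col_mult2) auto
  also have "\<dots> = H *\<^sub>v (A *\<^sub>v x)" using H A x by simp
  also have "\<dots> = e \<cdot>\<^sub>v unit_vec ?n 0" using H x by (simp add: Ax mult_mat_vec Hx)
  finally have colB: "col B 0 = e \<cdot>\<^sub>v unit_vec ?n 0" .
  have B0: "B $$ (i, 0) = (if i = 0 then e else 0)" if "i < ?n" for i
  proof -
    have "B $$ (i, 0) = col B 0 $ i" using B that by simp
    then show ?thesis using that by (simp add: colB)
  qed
  have B0': "B $$ (0, i) = (if i = 0 then e else 0)" if "i < ?n" for i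
    using B0[OF that] Bsym B that by (metis carrier_matD index_transpose_mat(1) zero_less_Suc)
  define B' where "B' = Matrix.mat m m (\<lambda>(i, j). B $$ (Suc i, Suc j))"
  have B': "B' \<in> carrier_mat m m" by (simp add: B'_def)
  have BB': "B = four_block_mat (mat_diag 1 (\<lambda>_. e)) (0\<^sub>m 1 m) (0\<^sub>m m 1) B'"
    using B B0 B0' by (intro eq_matI) (auto simp: B'_def mat_diag_def)
  have "transpose_mat B' = B'"
  proof (intro eq_matI)
    fix i j assume "i < dim_row B'" "j < dim_col B'"
    then have ij: "i < m" "j < m" by (simp_all add: B'_def)
    then have "B $$ (Suc j, Suc i) = B $$ (Suc i, Suc j)"
      using Bsym B by (metis carrier_matD index_transpose_mat(1) Suc_mono)
    then show "transpose_mat B' $$ (i, j) = B' $$ (i, j)" using ij by (simp add: B'_def)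
  qed (use B' in auto)
  then obtain V d where V: "V \<in> carrier_mat m m" "transpose_mat V * V = 1\<^sub>m m"
    "B' = V * mat_diag m d * transpose_mat V"
    using Suc.IH[OF B'] by blast
  define G where "G = four_block_mat (1\<^sub>m 1) (0\<^sub>m 1 m) (0\<^sub>m m 1) V"
  have G: "G \<in> carrier_mat ?n ?n" using V by (auto simp: G_def)
  have GT: "transpose_mat G = four_block_mat (1\<^sub>m 1) (0\<^sub>m 1 m) (0\<^sub>m m 1) (transpose_mat V)"
    unfolding G_def using V by (subst transpose_four_block_mat[of _ 1 1 _ m _ m]) auto
  define D where "D = mat_diag ?n (case_nat e d)"
  have D: "D \<in> carrier_mat ?n ?n" by (simp add: D_def)
  have GG: "transpose_mat G * G = 1\<^sub>m ?n"
    unfolding GT unfolding G_def using V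
    by (subst mult_four_block_mat[of _ 1 1 _ m _ m]) (auto simp: four_block_one_mat)
  have "G * D = four_block_mat (mat_diag 1 (\<lambda>_. e)) (0\<^sub>m 1 m) (0\<^sub>m m 1) (V * mat_diag m d)"
    unfolding G_def D_def mat_diag_Suc
    using V(1)
    by (subst mult_four_block_mat[of _ 1 1 _ m _ m])
      (auto simp: left_mult_one_mat[OF mat_diag_dim] left_mult_zero_mat[OF mat_diag_dim]
        right_add_zero_mat[OF mat_diag_dim])
  moreover have VD: "V * mat_diag m d \<in> carrier_mat m m" using V by simp
  moreover have VDV: "V * mat_diag m d * transpose_mat V \<in> carrier_mat m m" using B' V(3) by simp
  ultimately have GDG: "G * D * transpose_mat G = B"
    unfolding GT BB' using V(1,3)
    by (simp, subst mult_four_block_mat[of _ 1 1 _ m _ m])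
      (auto simp: right_mult_one_mat[OF mat_diag_dim] left_mult_zero_mat[OF mat_diag_dim]
        right_mult_zero_mat[OF VD] right_mult_zero_mat[OF mat_diag_dim]
        right_add_zero_mat[OF mat_diag_dim]
        left_add_zero_mat[OF VDV])
  define U where "U = H * G"
  have U: "U \<in> carrier_mat ?n ?n" using H G by (simp add: U_def)
  have UT: "transpose_mat U = transpose_mat G * H"
    using H(1,2) G unfolding U_def by (subst transpose_mult[of _ ?n ?n _ ?n]) simp_all
  have "transpose_mat U * U = transpose_mat G * (H * H) * G"
    unfolding UT unfolding U_def using H(1) G by (simp add: assoc_mult_mat[of _ ?n ?n _ ?n _ ?n])
  then have "transpose_mat U * U = 1\<^sub>m ?n" using G by (simp add: H GG)
  moreover have "U * D * transpose_mat U = A"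
  proof -
    have "U * D * transpose_mat U = H * (G * D * transpose_mat G) * H"
      unfolding UT unfolding U_def using H(1) G D
      by (simp add: assoc_mult_mat[of _ ?n ?n _ ?n _ ?n])
    also have "\<dots> = (H * H) * A * (H * H)"
      using H(1) A unfolding GDG B_def
      by (simp add: assoc_mult_mat[of _ ?n ?n _ ?n _ ?n])
    finally show ?thesis using A by (simp add: H)
  qed
  ultimately show ?case using U unfolding D_def by metis
qed

text \<open>\<open>u l\<close> is the \<open>l\<close>-th eigenvector and \<open>e l\<close> its
  eigenvalue, as plain functions, so that later arguments only handle finite sums. The third clause
  is completeness; the last one identifies the roots of the characteristic polynomial, with
  multiplicity, with the eigenvalues listed by \<open>e\<close>.\<close>

lemma symmetric_mat_spectral:
  fixes A :: "real Matrix.mat"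
  assumes A: "A \<in> carrier_mat n n" and sym: "transpose_mat A = A"
  obtains u :: "nat \<Rightarrow> nat \<Rightarrow> real" and e :: "nat \<Rightarrow> real" where
    "\<And>i j. i < n \<Longrightarrow> j < n \<Longrightarrow> A $$ (i, j) = (\<Sum>l<n. e l * (u l i * u l j))"
    "\<And>l m. l < n \<Longrightarrow> m < n \<Longrightarrow> (\<Sum>i<n. u l i * u m i) = (if l = m then 1 else 0)"
    "\<And>i j. i < n \<Longrightarrow> j < n \<Longrightarrow> (\<Sum>l<n. u l i * u l j) = (if i = j then 1 else 0)"
    "\<And>\<tau>. threshold_rank \<tau> A = card {l. l < n \<and> e l > \<tau>}"
proof -
  obtain U d where U: "U \<in> carrier_mat n n" and UTU: "transpose_mat U * U = 1\<^sub>m n"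
    and AU: "A = U * mat_diag n d * transpose_mat U"
    using symmetric_mat_diagonalization[OF A sym] by blast
  have UT: "transpose_mat U \<in> carrier_mat n n" using U by simp
  have UUT: "U * transpose_mat U = 1\<^sub>m n"
    using mat_mult_left_right_inverse[OF UT U UTU] .
  define u where "u l i = U $$ (i, l)" for l i
  have 1: "A $$ (i, j) = (\<Sum>l<n. d l * (u l i * u l j))" if ij: "i < n" "j < n" for i j
  proof -
    define M where "M = U * mat_diag n d"
    have "M \<in> carrier_mat n n" using U by (simp add: M_def)
    then have "A $$ (i, j) = (\<Sum>l<n. M $$ (i, l) * U $$ (j, l))"
      unfolding AU M_def[symmetric] using U ij by (simp add: scalar_prod_def atLeast0LessThan)
    also have "\<dots> = (\<Sum>l<n. (U * mat_diag n d) $$ (i, l) * U $$ (j, l))"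
      by (simp only: M_def)
    also have "\<dots> = (\<Sum>l<n. d l * (u l i * u l j))"
      using U ij by (subst mat_diag_mult_right[of _ n]) (auto simp: u_def intro!: sum.cong)
    finally show ?thesis .
  qed
  have 2: "(\<Sum>i<n. u l i * u m i) = (if l = m then 1 else 0)" if "l < n" "m < n" for l m
  proof -
    have "(transpose_mat U * U) $$ (l, m) = (\<Sum>i<n. u l i * u m i)"
      using U that by (simp add: u_def times_mat_def scalar_prod_def atLeast0LessThan)
    then show ?thesis using that unfolding UTU by simp
  qed
  have 3: "(\<Sum>l<n. u l i * u l j) = (if i = j then 1 else 0)" if "i < n" "j < n" for i j
  proof -
    have "(U * transpose_mat U) $$ (i, j) = (\<Sum>l<n. u l i * u l j)"
      using U that by (simp add: u_def times_mat_def scalar_prod_def atLeast0LessThan)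
    then show ?thesis using that unfolding UUT by simp
  qed
  have "similar_mat A (mat_diag n d)"
    unfolding similar_mat_def using AU U UT UUT UTU A
    by (intro exI[of _ U] exI[of _ "transpose_mat U"] similar_mat_witI) auto
  then have "char_poly A = char_poly (mat_diag n d)" by (rule char_poly_similar)
  also have "\<dots> = (\<Prod>a\<leftarrow>diag_mat (mat_diag n d). [:- a, 1:])"
    by (rule char_poly_upper_triangular[of _ n]) (auto simp: mat_diag_def)
  also have "diag_mat (mat_diag n d) = map d [0..<n]"
    by (auto simp: diag_mat_def mat_diag_def)
  finally have "char_poly A = (\<Prod>l\<leftarrow>[0..<n]. [:- d l, 1:])" by (simp add: o_def)
  \<comment> \<open>Nonzeroness is carried through the induction because \<open>proots\<close> turns
    products into sums of multisets only for nonzero factors.\<close>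
  moreover have "(\<Prod>l\<leftarrow>ls. [:- d l, 1:]) \<noteq> 0
      \<and> proots (\<Prod>l\<leftarrow>ls. [:- d l, 1:]) = image_mset d (mset ls)" for ls
    by (induction ls) (auto simp: proots_mult proots_linear_factor simp del: mult_pCons_left)
  ultimately have "proots (char_poly A) = image_mset d (mset [0..<n])" by metis
  also have "mset [0..<n] = mset_set {..<n}"
    by (simp add: atLeast0LessThan)
  finally have proots: "proots (char_poly A) = image_mset d (mset_set {..<n})" .
  have 4: "threshold_rank \<tau> A = card {l. l < n \<and> d l > \<tau>}" for \<tau>
    unfolding threshold_rank_def proots by (simp add: filter_mset_image_mset)
  show ?thesis using 1 2 3 4 by (rule that)
qed

text \<open>The part of \<open>A\<close> with eigenvalues above \<open>\<tau>\<close>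
  is bounded by an orthogonal projection, whose squared Frobenius norm is the threshold rank.\<close>

lemma trace_gram_le_threshold_rank:
  fixes A :: "real Matrix.mat" and W :: "nat \<Rightarrow> 'a \<Rightarrow> real" and K :: "nat \<Rightarrow> nat \<Rightarrow> real"
  assumes A: "A \<in> carrier_mat n n" and sym: "transpose_mat A = A"
    and le1: "\<And>y :: nat \<Rightarrow> real. (\<Sum>i<n. \<Sum>j<n. A $$ (i, j) * (y i * y j)) \<le> (\<Sum>i<n. (y i)\<^sup>2)"
    and K: "\<And>i j. i < n \<Longrightarrow> j < n \<Longrightarrow> K i j = (\<Sum>z\<in>Z. W i z * W j z)"
    and \<tau>: "0 \<le> \<tau>"
  shows "(\<Sum>i<n. \<Sum>j<n. A $$ (i, j) * K i j)
    \<le> \<tau> * (\<Sum>i<n. K i i) + sqrt (threshold_rank \<tau> A * (\<Sum>i<n. \<Sum>j<n. (K i j)\<^sup>2))"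
proof -
  obtain u e where Ae: "\<And>i j. i < n \<Longrightarrow> j < n \<Longrightarrow> A $$ (i, j) = (\<Sum>l<n. e l * (u l i * u l j))"
    and orth: "\<And>l m. l < n \<Longrightarrow> m < n \<Longrightarrow> (\<Sum>i<n. u l i * u m i) = (if l = m then 1 else 0 :: real)"
    and compl: "\<And>i j. i < n \<Longrightarrow> j < n \<Longrightarrow> (\<Sum>l<n. u l i * u l j) = (if i = j then 1 else 0 :: real)"
    and rank: "\<And>\<tau>. threshold_rank \<tau> A = card {l. l < n \<and> e l > \<tau>}"
    by (rule symmetric_mat_spectral[OF A sym]) (rule that)
  define B where "B = {l. l < n \<and> e l > \<tau>}"
  have B: "B \<subseteq> {..<n}" "finite B" "\<And>l. l \<in> B \<Longrightarrow> l < n" by (auto simp: B_def)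
  \<comment> \<open>The quadratic form of \<open>K\<close> at \<open>u l\<close>. It is a sum of
    squares over \<open>Z\<close>, hence nonnegative, so bounds on \<open>e l\<close> may be
    multiplied by it.\<close>
  define q where "q l = (\<Sum>i<n. \<Sum>j<n. u l i * u l j * K i j)" for l
  have q_eq: "q l = (\<Sum>z\<in>Z. (\<Sum>i<n. u l i * W i z)\<^sup>2)" for l
  proof -
    have "q l = (\<Sum>i<n. \<Sum>j<n. \<Sum>z\<in>Z. (u l i * W i z) * (u l j * W j z))"
      unfolding q_def by (intro sum.cong refl) (auto simp: K sum_distrib_left mult_ac)
    also have "\<dots> = (\<Sum>i<n. \<Sum>z\<in>Z. \<Sum>j<n. (u l i * W i z) * (u l j * W j z))"
      by (intro sum.cong refl sum.swap)
    also have "\<dots> = (\<Sum>z\<in>Z. \<Sum>i<n. \<Sum>j<n. (u l i * W i z) * (u l j * W j z))"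
      by (rule sum.swap)
    finally show ?thesis by (simp add: power2_eq_square sum_product)
  qed
  have q0: "q l \<ge> 0" for l unfolding q_eq by (intro sum_nonneg) simp
  \<comment> \<open>The form of \<open>A\<close> at the unit eigenvector \<open>u l\<close> is
    \<open>e l\<close>, to which \<open>le1\<close> applies.\<close>
  have e1: "e l \<le> 1" if l: "l < n" for l
  proof -
    have "(\<Sum>i<n. \<Sum>j<n. A $$ (i, j) * (u l i * u l j))
      = (\<Sum>i<n. \<Sum>j<n. \<Sum>m<n. e m * ((u m i * u l i) * (u m j * u l j)))"
      by (intro sum.cong refl) (auto simp: Ae sum_distrib_left sum_distrib_right mult_ac)
    also have "\<dots> = (\<Sum>i<n. \<Sum>m<n. \<Sum>j<n. e m * ((u m i * u l i) * (u m j * u l j)))"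
      by (intro sum.cong refl sum.swap)
    also have "\<dots> = (\<Sum>m<n. \<Sum>i<n. \<Sum>j<n. e m * ((u m i * u l i) * (u m j * u l j)))"
      by (rule sum.swap)
    also have "\<dots> = (\<Sum>m<n. e m * (\<Sum>i<n. \<Sum>j<n. (u m i * u l i) * (u m j * u l j)))"
      by (simp only: sum_distrib_left)
    also have "\<dots> = (\<Sum>m<n. e m * ((\<Sum>i<n. u m i * u l i) * (\<Sum>j<n. u m j * u l j)))"
      by (simp only: sum_product)
    also have "\<dots> = (\<Sum>m<n. if m = l then e m else 0)"
      using l by (intro sum.cong refl) (auto simp: orth)
    also have "\<dots> = e l" using l by simp
    finally have "e l \<le> (\<Sum>i<n. (u l i)\<^sup>2)" using le1[of "u l"] by simp
    also have "\<dots> = 1" using orth[OF l l] by (simp add: power2_eq_square)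
    finally show ?thesis .
  qed
  have "(\<Sum>i<n. \<Sum>j<n. A $$ (i, j) * K i j) = (\<Sum>i<n. \<Sum>j<n. \<Sum>l<n. e l * (u l i * u l j * K i j))"
    by (intro sum.cong refl) (auto simp: Ae sum_distrib_left sum_distrib_right mult_ac)
  also have "\<dots> = (\<Sum>i<n. \<Sum>l<n. \<Sum>j<n. e l * (u l i * u l j * K i j))"
    by (intro sum.cong refl sum.swap)
  also have "\<dots> = (\<Sum>l<n. \<Sum>i<n. \<Sum>j<n. e l * (u l i * u l j * K i j))"
    by (rule sum.swap)
  also have "\<dots> = (\<Sum>l<n. e l * q l)"
    by (simp add: q_def sum_distrib_left)
  \<comment> \<open>Eigenvalues outside \<open>B\<close> are at most \<open>\<tau>\<close>, those
    inside at most 1.\<close>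
  also have "\<dots> \<le> (\<Sum>l<n. \<tau> * q l + (if l \<in> B then q l else 0))"
  proof (intro sum_mono)
    fix l assume "l \<in> {..<n}"
    then have l: "l < n" by simp
    show "e l * q l \<le> \<tau> * q l + (if l \<in> B then q l else 0)"
    proof (cases "l \<in> B")
      case True
      have "e l * q l \<le> 1 * q l" using e1[OF l] q0 by (intro mult_right_mono)
      moreover have "0 \<le> \<tau> * q l" using \<tau> q0 by simp
      ultimately show ?thesis using True by simp
    next
      case False
      then have "e l \<le> \<tau>" using l by (simp add: B_def)
      then have "e l * q l \<le> \<tau> * q l" using q0 by (intro mult_right_mono)
      then show ?thesis using False by simp
    qed
  qed
  also have "\<dots> = \<tau> * (\<Sum>l<n. q l) + (\<Sum>l\<in>B. q l)"
    using B by (simp add: sum.distrib sum_distrib_left sum.If_cases Int_absorb1 inf.absorb2)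
  \<comment> \<open>Completeness: the trace of \<open>K\<close> can be computed in the orthonormal
    basis of eigenvectors.\<close>
  also have "(\<Sum>l<n. q l) = (\<Sum>i<n. K i i)"
  proof -
    have "(\<Sum>l<n. q l) = (\<Sum>i<n. \<Sum>l<n. \<Sum>j<n. u l i * u l j * K i j)"
      unfolding q_def by (rule sum.swap)
    also have "\<dots> = (\<Sum>i<n. \<Sum>j<n. \<Sum>l<n. u l i * u l j * K i j)"
      by (intro sum.cong refl sum.swap)
    also have "\<dots> = (\<Sum>i<n. \<Sum>j<n. if j = i then K i j else 0)"
      by (intro sum.cong refl) (auto simp: compl simp flip: sum_distrib_right)
    finally show ?thesis by simp
  qed
  also have "(\<Sum>l\<in>B. q l) \<le> sqrt (threshold_rank \<tau> A * (\<Sum>i<n. \<Sum>j<n. (K i j)\<^sup>2))"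
  proof -
    \<comment> \<open>\<open>P\<close> is the orthogonal projection onto the span of the
      eigenvectors in \<open>B\<close>. The sum of \<open>q\<close> over \<open>B\<close> is its
      Frobenius inner product with \<open>K\<close>, to which Cauchy-Schwarz applies.\<close>
    define P where "P i j = (\<Sum>l\<in>B. u l i * u l j)" for i j
    have "(\<Sum>l\<in>B. q l) = (\<Sum>i<n. \<Sum>l\<in>B. \<Sum>j<n. u l i * u l j * K i j)"
      unfolding q_def by (rule sum.swap)
    also have "\<dots> = (\<Sum>i<n. \<Sum>j<n. \<Sum>l\<in>B. u l i * u l j * K i j)"
      by (intro sum.cong refl sum.swap)
    also have "\<dots> = (\<Sum>i<n. \<Sum>j<n. P i j * K i j)"
      by (simp add: P_def sum_distrib_right)
    finally have qP: "(\<Sum>l\<in>B. q l) = (\<Sum>(i, j)\<in>{..<n} \<times> {..<n}. P i j * K i j)"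
      by (simp add: sum.cartesian_product)
    have "(\<Sum>i<n. \<Sum>j<n. (P i j)\<^sup>2)
      = (\<Sum>i<n. \<Sum>j<n. \<Sum>l\<in>B. \<Sum>m\<in>B. (u l i * u m i) * (u l j * u m j))"
      unfolding P_def power2_eq_square sum_product by (intro sum.cong refl) (simp add: mult_ac)
    also have "\<dots> = (\<Sum>i<n. \<Sum>l\<in>B. \<Sum>j<n. \<Sum>m\<in>B. (u l i * u m i) * (u l j * u m j))"
      by (intro sum.cong refl sum.swap)
    also have "\<dots> = (\<Sum>i<n. \<Sum>l\<in>B. \<Sum>m\<in>B. \<Sum>j<n. (u l i * u m i) * (u l j * u m j))"
      by (intro sum.cong refl sum.swap)
    also have "\<dots> = (\<Sum>l\<in>B. \<Sum>i<n. \<Sum>m\<in>B. \<Sum>j<n. (u l i * u m i) * (u l j * u m j))"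
      by (rule sum.swap)
    also have "\<dots> = (\<Sum>l\<in>B. \<Sum>m\<in>B. \<Sum>i<n. \<Sum>j<n. (u l i * u m i) * (u l j * u m j))"
      by (intro sum.cong refl sum.swap)
    also have "\<dots> = (\<Sum>l\<in>B. \<Sum>m\<in>B. if m = l then 1 else 0)"
      by (intro sum.cong refl) (auto simp: sum_product[symmetric] orth B(3))
    also have "\<dots> = card B" using B(2) by simp
    finally have PP: "(\<Sum>(i, j)\<in>{..<n} \<times> {..<n}. (P i j)\<^sup>2) = card B"
      by (simp add: sum.cartesian_product)
    have "(\<Sum>l\<in>B. q l)\<^sup>2 \<le> card B * (\<Sum>i<n. \<Sum>j<n. (K i j)\<^sup>2)"
      using Cauchy_Schwarz_ineq_sum[of "\<lambda>(i, j). P i j" "\<lambda>(i, j). K i j" "{..<n} \<times> {..<n}"] PP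
      unfolding qP by (simp add: case_prod_unfold sum.cartesian_product)
    then show ?thesis
      unfolding rank B_def[symmetric] by (rule real_le_rsqrt)
  qed
  finally show ?thesis by simp
qed

section \<open>Edge averages and global averages\<close>

lemma finite_ug_instance:
  assumes "ug_instance n k I"
  shows "finite (set_pmf I)"
proof (rule finite_subset)
  show "set_pmf I \<subseteq> {..<n} \<times> {..<n} \<times> {\<pi>. \<pi> permutes {..<k}}"
    using assms by (auto simp: ug_instance_def)
qed (auto intro: finite_permutations)

text \<open>\<open>edge_weight\<close> is indexed by ordered pairs but measures unordered ones: a
  constraint on distinct vertices is counted at \<open>(a, b)\<close> and at \<open>(b, a)\<close>,
  a loop only once.\<close>

lemma edge_weight_sum:
  fixes f :: "nat \<Rightarrow> nat \<Rightarrow> real"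
  assumes I: "ug_instance n k I"
  shows "(\<Sum>i<n. \<Sum>j<n. edge_weight I i j * f i j) =
    measure_pmf.expectation I (\<lambda>(a, b, \<pi>). if a = b then f a a else f a b + f b a)"
proof -
  have int: "integrable (measure_pmf I) g" for g :: "_ \<Rightarrow> real"
    by (rule integrable_measure_pmf_finite[OF finite_ug_instance[OF I]])
  have w: "edge_weight I i j = measure_pmf.expectation I (\<lambda>e. if {fst e, fst (snd e)} = {i, j} then 1 else 0)" for i j
  proof -
    have "edge_weight I i j = measure_pmf.expectation I (indicator {(a, b, \<pi>). {a, b} = {i, j}})"
      by (simp add: edge_weight_def)
    also have "\<dots> = measure_pmf.expectation I (\<lambda>e. if {fst e, fst (snd e)} = {i, j} then 1 else 0)"
      by (intro Bochner_Integration.integral_cong refl) (simp add: indicator_def case_prod_unfold)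
    finally show ?thesis .
  qed
  have "(\<Sum>i<n. \<Sum>j<n. edge_weight I i j * f i j) = measure_pmf.expectation I
    (\<lambda>e. \<Sum>i<n. \<Sum>j<n. (if {fst e, fst (snd e)} = {i, j} then 1 else 0) * f i j)"
    by (subst Bochner_Integration.integral_sum, rule int, intro sum.cong refl,
        subst Bochner_Integration.integral_sum, rule int, intro sum.cong refl)
      (simp add: w)
  also have "\<dots> = measure_pmf.expectation I (\<lambda>(a, b, \<pi>). if a = b then f a a else f a b + f b a)"
  proof (intro integral_cong_AE)
    show "AE e in measure_pmf I. (\<Sum>i<n. \<Sum>j<n. (if {fst e, fst (snd e)} = {i, j} then 1 else 0) * f i j)
       = (case e of (a, b, \<pi>) \<Rightarrow> if a = b then f a a else f a b + f b a)"
    proof (rule AE_pmfI)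
      fix e assume "e \<in> set_pmf I"
      then obtain a b \<pi> where e: "e = (a, b, \<pi>)" "a < n" "b < n"
        using I by (cases e) (auto simp: ug_instance_def)
      have inner: "(\<Sum>j<n. if i = x then if j = y then g i j else 0 else 0)
        = (if i = x then g i y else 0)" if "y < n" for x y i and g :: "nat \<Rightarrow> nat \<Rightarrow> real"
        using that by simp
      have "(\<Sum>i<n. \<Sum>j<n. (if {a, b} = {i, j} then 1 else 0) * f i j)
        = (\<Sum>i<n. \<Sum>j<n. (if i = a then if j = b then f i j else 0 else 0)
            + (if i = b then if j = a then (if a = b then 0 else f i j) else 0 else 0))"
        by (intro sum.cong refl) (auto simp: doubleton_eq_iff)
      also have "\<dots> = f a b + (if a = b then 0 else f b a)"
        unfolding sum.distrib inner[OF e(3)] inner[OF e(2), of _ b "\<lambda>i j. if a = b then 0 else f i j"]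
        using e by simp
      finally show "(\<Sum>i<n. \<Sum>j<n. (if {fst e, fst (snd e)} = {i, j} then 1 else 0) * f i j)
       = (case e of (a, b, \<pi>) \<Rightarrow> if a = b then f a a else f a b + f b a)"
        using e by auto
    qed
  qed auto
  finally show ?thesis .
qed

lemma edge_weight_nonneg: "0 \<le> edge_weight I i j"
  by (simp add: edge_weight_def)

lemma edge_weight_commute: "edge_weight I i j = edge_weight I j i"
  by (simp add: edge_weight_def insert_commute)

context
  fixes n k :: nat and I :: ug and D :: real
  assumes I: "ug_instance n k I"
    and D: "\<And>i. i < n \<Longrightarrow> weighted_degree n I i = D"
begin

lemma n_pos: "0 < n"
  using I set_pmf_not_empty[of I] by (force simp: ug_instance_def)

text \<open>\<open>D * n\<close> is the sum of all edge weights, to which a loop contributes its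
  mass once and every other constraint twice.\<close>

lemma degree_bounds: "1 \<le> D * n" "D * n \<le> 2"
proof -
  have int: "integrable (measure_pmf I) g" for g :: "_ \<Rightarrow> real"
    by (rule integrable_measure_pmf_finite[OF finite_ug_instance[OF I]])
  have "D * n = (\<Sum>i<n. \<Sum>j<n. edge_weight I i j * 1)"
    using D by (simp add: weighted_degree_def)
  also have "\<dots> = measure_pmf.expectation I (\<lambda>(a, b, \<pi>). if a = b then 1 else 1 + 1 :: real)"
    by (rule edge_weight_sum[OF I])
  finally have eq: "D * n = measure_pmf.expectation I (\<lambda>(a, b, \<pi>). if a = b then 1 else 1 + 1 :: real)" .
  show "1 \<le> D * n" unfolding eq
    by (rule measure_pmf.integral_ge_const[OF int]) auto
  show "D * n \<le> 2" unfolding eq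
    by (rule measure_pmf.integral_le_const[OF int]) auto
qed

lemma degree_pos: "D > 0"
  using degree_bounds(1) n_pos by (smt (verit) mult_nonpos_nonneg of_nat_0_le_iff)

lemma normalized_adjacency_index:
  "i < n \<Longrightarrow> j < n \<Longrightarrow> normalized_adjacency n I $$ (i, j) = edge_weight I i j / D"
  by (simp add: normalized_adjacency_def D)

lemma normalized_adjacency_carrier: "normalized_adjacency n I \<in> carrier_mat n n"
  by (simp add: normalized_adjacency_def)

lemma normalized_adjacency_symmetric:
  "transpose_mat (normalized_adjacency n I) = normalized_adjacency n I"
  using normalized_adjacency_carrier
  by (intro eq_matI) (auto simp: normalized_adjacency_index edge_weight_commute)

text \<open>By \<open>2 * y i * y j \<le> (y i)^2 + (y j)^2\<close> and since every row of edge
  weights sums to \<open>D\<close>. This is the spectral bound 1 that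
  \<open>trace_gram_le_threshold_rank\<close> asks for.\<close>

lemma normalized_adjacency_quadratic_form_le:
  "(\<Sum>i<n. \<Sum>j<n. normalized_adjacency n I $$ (i, j) * (y i * y j)) \<le> (\<Sum>i<n. (y i)\<^sup>2)"
proof -
  have row: "(\<Sum>j<n. edge_weight I i j) = D" if "i < n" for i
    using D[OF that] by (simp add: weighted_degree_def)
  have "(\<Sum>i<n. \<Sum>j<n. edge_weight I i j * (y i * y j))
    \<le> (\<Sum>i<n. \<Sum>j<n. edge_weight I i j * (((y i)\<^sup>2 + (y j)\<^sup>2) / 2))"
  proof (intro sum_mono mult_left_mono edge_weight_nonneg)
    fix i j
    show "y i * y j \<le> ((y i)\<^sup>2 + (y j)\<^sup>2) / 2"
      using sum_squares_bound[of "y i" "y j"] by simp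
  qed
  also have "\<dots> = ((\<Sum>i<n. \<Sum>j<n. edge_weight I i j * (y i)\<^sup>2) + (\<Sum>i<n. \<Sum>j<n. edge_weight I i j * (y j)\<^sup>2)) / 2"
    by (simp add: sum.distrib sum_divide_distrib add_divide_distrib algebra_simps)
  also have "(\<Sum>i<n. \<Sum>j<n. edge_weight I i j * (y j)\<^sup>2) = (\<Sum>j<n. \<Sum>i<n. edge_weight I j i * (y j)\<^sup>2)"
    by (subst sum.swap) (simp add: edge_weight_commute)
  also have "(\<Sum>i<n. \<Sum>j<n. edge_weight I i j * (y i)\<^sup>2) = D * (\<Sum>i<n. (y i)\<^sup>2)"
    by (simp add: row sum_distrib_left flip: sum_distrib_right)
  finally have *: "(\<Sum>i<n. \<Sum>j<n. edge_weight I i j * (y i * y j)) \<le> D * (\<Sum>i<n. (y i)\<^sup>2)"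
    by simp
  have "(\<Sum>i<n. \<Sum>j<n. normalized_adjacency n I $$ (i, j) * (y i * y j))
    = (\<Sum>i<n. \<Sum>j<n. edge_weight I i j * (y i * y j)) / D"
    by (simp add: normalized_adjacency_index sum_divide_distrib)
  then show ?thesis using * degree_pos by (simp add: divide_le_eq mult.commute)
qed

text \<open>The passage from local to global correlation. The first term pays for the eigenvalues up
  to \<open>\<tau>\<close>, the root for the remaining ones; both factors 2 are the bound on
  \<open>D * n\<close>.\<close>

lemma edge_average_le_global_average:
  fixes W :: "nat \<Rightarrow> 'z \<Rightarrow> real" and K :: "nat \<Rightarrow> nat \<Rightarrow> real"
  assumes K: "\<And>i j. i < n \<Longrightarrow> j < n \<Longrightarrow> K i j = (\<Sum>z\<in>Z. W i z * W j z)"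
    and K0: "\<And>i j. i < n \<Longrightarrow> j < n \<Longrightarrow> 0 \<le> K i j"
    and K1: "\<And>i j. i < n \<Longrightarrow> j < n \<Longrightarrow> K i j \<le> 1"
    and \<tau>: "0 \<le> \<tau>"
  shows "measure_pmf.expectation I (\<lambda>(a, b, \<pi>). K a b) \<le> 2 * \<tau> +
    2 * sqrt (threshold_rank \<tau> (normalized_adjacency n I) * ((\<Sum>i<n. \<Sum>j<n. K i j) / n\<^sup>2))"
proof -
  let ?A = "normalized_adjacency n I"
  have int: "integrable (measure_pmf I) g" for g :: "_ \<Rightarrow> real"
    by (rule integrable_measure_pmf_finite[OF finite_ug_instance[OF I]])
  have "measure_pmf.expectation I (\<lambda>(a, b, \<pi>). K a b)
    \<le> measure_pmf.expectation I (\<lambda>(a, b, \<pi>). if a = b then K a a else K a b + K b a)"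
  proof (rule integral_mono_AE[OF int int], rule AE_pmfI)
    fix e assume "e \<in> set_pmf I"
    then obtain a b \<pi> where "e = (a, b, \<pi>)" "a < n" "b < n"
      using I by (cases e) (auto simp: ug_instance_def)
    then show "(case e of (a, b, \<pi>) \<Rightarrow> K a b)
      \<le> (case e of (a, b, \<pi>) \<Rightarrow> if a = b then K a a else K a b + K b a)"
      using K0 by auto
  qed
  also have "\<dots> = (\<Sum>i<n. \<Sum>j<n. edge_weight I i j * K i j)"
    by (rule edge_weight_sum[OF I, symmetric])
  also have "\<dots> = D * (\<Sum>i<n. \<Sum>j<n. ?A $$ (i, j) * K i j)"
    using degree_pos by (simp add: normalized_adjacency_index sum_distrib_left)
  also have "\<dots> \<le> D * (\<tau> * (\<Sum>i<n. K i i) + sqrt (threshold_rank \<tau> ?A * (\<Sum>i<n. \<Sum>j<n. (K i j)\<^sup>2)))"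
    using degree_pos
    by (intro mult_left_mono trace_gram_le_threshold_rank[where W = W and Z = Z] K \<tau>
        normalized_adjacency_carrier normalized_adjacency_symmetric
        normalized_adjacency_quadratic_form_le) auto
  \<comment> \<open>Diagonal entries at most 1 bound the trace by \<open>n\<close>, and entries in
    [0, 1] dominate their squares.\<close>
  also have "\<dots> \<le> D * (\<tau> * n + sqrt (threshold_rank \<tau> ?A * (\<Sum>i<n. \<Sum>j<n. K i j)))"
  proof (intro mult_left_mono add_mono real_sqrt_le_mono sum_mono)
    have "(\<Sum>i<n. K i i) \<le> (\<Sum>i<n. 1)" using K1 by (intro sum_mono) auto
    then show "(\<Sum>i<n. K i i) \<le> n" by simp
    fix i j assume ij: "i \<in> {..<n}" "j \<in> {..<n}"
    then have "K i j * K i j \<le> K i j * 1" using K0 K1 by (intro mult_left_mono) auto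
    then show "(K i j)\<^sup>2 \<le> K i j" by (simp add: power2_eq_square)
  qed (use \<tau> degree_pos in auto)
  also have "\<dots> = (D * n) * (\<tau> + sqrt (threshold_rank \<tau> ?A * ((\<Sum>i<n. \<Sum>j<n. K i j) / n\<^sup>2)))"
    using n_pos by (simp add: real_sqrt_divide algebra_simps)
  also have "\<dots> \<le> 2 * (\<tau> + sqrt (threshold_rank \<tau> ?A * ((\<Sum>i<n. \<Sum>j<n. K i j) / n\<^sup>2)))"
    using degree_bounds \<tau> K0
    by (intro mult_right_mono add_nonneg_nonneg real_sqrt_ge_zero mult_nonneg_nonneg
        divide_nonneg_nonneg sum_nonneg) auto
  finally show ?thesis by (simp add: algebra_simps)
qed

text \<open>The all-ones vector has eigenvalue 1: with threshold rank 0, the trace bound for the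
  all-ones kernel would read \<open>n \<le> \<tau> * n\<close>.\<close>

lemma threshold_rank_pos:
  assumes \<tau>: "0 \<le> \<tau>" "\<tau> < 1"
  shows "0 < threshold_rank \<tau> (normalized_adjacency n I)"
proof (rule ccontr)
  let ?A = "normalized_adjacency n I"
  assume "\<not> 0 < threshold_rank \<tau> ?A"
  then have 0: "threshold_rank \<tau> ?A = 0" by simp
  have "(\<Sum>i<n. \<Sum>j<n. ?A $$ (i, j) * 1) = (\<Sum>i<n. weighted_degree n I i / D)"
    by (simp add: normalized_adjacency_index weighted_degree_def sum_divide_distrib)
  also have "\<dots> = n" using degree_pos by (simp add: D)
  finally have "real n = (\<Sum>i<n. \<Sum>j<n. ?A $$ (i, j) * 1)" by simp
  also have "\<dots> \<le> \<tau> * (\<Sum>i<n. 1) + sqrt (real (threshold_rank \<tau> ?A) * (\<Sum>i<n. \<Sum>j<n. 1\<^sup>2))"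
    using \<tau>
    by (intro trace_gram_le_threshold_rank[where W = "\<lambda>_ _. 1" and Z = "{()}"]
        normalized_adjacency_carrier normalized_adjacency_symmetric
        normalized_adjacency_quadratic_form_le) auto
  finally show False using 0 \<tau> n_pos by simp
qed

end

section \<open>Pairwise correlations\<close>

text \<open>What is kept of a Lasserre solution after conditioning on a seed: label probabilities
  \<open>p\<close>, pair probabilities \<open>q\<close> (also for \<open>i = j\<close>) and vectors
  \<open>U i a\<close> representing \<open>q\<close>. \<open>U0\<close> represents the certain
  event; with it covariances, and not only joint probabilities, become inner products.\<close>

locale pairwise_distribution =
  fixes n k N :: nat and p :: "nat \<Rightarrow> nat \<Rightarrow> real" and q :: "nat \<Rightarrow> nat \<Rightarrow> nat \<Rightarrow> nat \<Rightarrow> real"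
    and U :: "nat \<Rightarrow> nat \<Rightarrow> nat \<Rightarrow> real" and U0 :: "nat \<Rightarrow> real"
  assumes q_nonneg: "\<lbrakk>i < n; j < n; a < k; b < k\<rbrakk> \<Longrightarrow> 0 \<le> q i a j b"
    and q_sym: "\<lbrakk>i < n; j < n; a < k; b < k\<rbrakk> \<Longrightarrow> q i a j b = q j b i a"
    and q_marginal: "\<lbrakk>i < n; j < n; a < k\<rbrakk> \<Longrightarrow> (\<Sum>b<k. q i a j b) = p i a"
    and p_sum: "i < n \<Longrightarrow> (\<Sum>a<k. p i a) = 1"
    and gram: "\<lbrakk>i < n; j < n; a < k; b < k\<rbrakk> \<Longrightarrow> (\<Sum>t<N. U i a t * U j b t) = q i a j b"
    and gram_base: "\<lbrakk>i < n; a < k\<rbrakk> \<Longrightarrow> (\<Sum>t<N. U i a t * U0 t) = p i a"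
    and gram_base_base: "(\<Sum>t<N. U0 t * U0 t) = 1"
begin

definition cov :: "nat \<Rightarrow> nat \<Rightarrow> nat \<Rightarrow> nat \<Rightarrow> real" where
  "cov i a j b = q i a j b - p i a * p j b"

text \<open>The sum over all label pairs gives a kernel on vertices, and the weight splits into one
  factor per end. Labels of probability 0 contribute 0 by \<open>x / 0 = 0\<close>; their
  covariances vanish as well.\<close>

definition corr :: "nat \<Rightarrow> nat \<Rightarrow> real" where
  "corr i j = (\<Sum>a<k. \<Sum>b<k. (cov i a j b)\<^sup>2 / sqrt (p i a * p j b))"

text \<open>The decrease of \<open>\<Sum>a. Var(X\<^sub>i = a)\<close> caused by conditioning on \<open>X\<^sub>j\<close>.\<close>

definition gain :: "nat \<Rightarrow> nat \<Rightarrow> real" where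
  "gain i j = (\<Sum>a<k. (\<Sum>b<k. (q i a j b)\<^sup>2 / p j b) - (p i a)\<^sup>2)"

lemma p_nonneg: "0 \<le> p i a" if "i < n" "a < k"
  unfolding q_marginal[OF that(1) that(1) that(2), symmetric]
  using that by (intro sum_nonneg q_nonneg) auto

lemma q_le_left: "q i a j b \<le> p i a" if "i < n" "j < n" "a < k" "b < k"
proof -
  have "q i a j b \<le> (\<Sum>b<k. q i a j b)"
    using that by (intro member_le_sum q_nonneg) auto
  then show ?thesis using that by (simp add: q_marginal)
qed

lemma q_le_right: "q i a j b \<le> p j b" if "i < n" "j < n" "a < k" "b < k"
  using q_le_left[of j i b a] q_sym[OF that] that by simp

lemma q_eq_0: "q i a j b = 0" if "i < n" "j < n" "a < k" "b < k" "p i a = 0 \<or> p j b = 0"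
  using q_le_left[OF that(1-4)] q_le_right[OF that(1-4)] q_nonneg[OF that(1-4)] that(5) by auto

lemma cov_eq_0: "cov i a j b = 0" if "i < n" "j < n" "a < k" "b < k" "p i a = 0 \<or> p j b = 0"
  using q_eq_0[OF that] that(5) by (auto simp: cov_def)

lemma cov_sym: "cov i a j b = cov j b i a" if "i < n" "j < n" "a < k" "b < k"
  using q_sym[OF that] by (simp add: cov_def)

lemma corr_nonneg: "0 \<le> corr i j" if "i < n" "j < n"
  unfolding corr_def using that by (intro sum_nonneg divide_nonneg_nonneg) (auto simp: p_nonneg)

text \<open>Expand the square: the other terms collapse by the marginals of \<open>q\<close>. In
  this form \<open>gain\<close> and \<open>corr\<close> have the same numerators and differ only in
  the weight.\<close>

lemma gain_eq_cov: "gain i j = (\<Sum>a<k. \<Sum>b<k. (cov i a j b)\<^sup>2 / p j b)" if "i < n" "j < n"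
  unfolding gain_def
proof (intro sum.cong refl)
  fix a assume "a \<in> {..<k}"
  then have a: "a < k" by simp
  have "(\<Sum>b<k. (cov i a j b)\<^sup>2 / p j b)
    = (\<Sum>b<k. (q i a j b)\<^sup>2 / p j b - 2 * p i a * q i a j b + (p i a)\<^sup>2 * p j b)"
  proof (intro sum.cong refl)
    fix b assume "b \<in> {..<k}"
    then have b: "b < k" by simp
    show "(cov i a j b)\<^sup>2 / p j b
      = (q i a j b)\<^sup>2 / p j b - 2 * p i a * q i a j b + (p i a)\<^sup>2 * p j b"
      using q_eq_0[OF that a b]
      by (cases "p j b = 0") (simp_all add: cov_def field_simps power2_eq_square)
  qed
  also have "\<dots> = (\<Sum>b<k. (q i a j b)\<^sup>2 / p j b) - 2 * p i a * (\<Sum>b<k. q i a j b) + (p i a)\<^sup>2 * (\<Sum>b<k. p j b)"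
    by (simp add: sum.distrib sum_subtractf sum_distrib_left)
  also have "\<dots> = (\<Sum>b<k. (q i a j b)\<^sup>2 / p j b) - (p i a)\<^sup>2"
    using that a by (simp add: q_marginal p_sum power2_eq_square)
  finally show "(\<Sum>b<k. (q i a j b)\<^sup>2 / p j b) - (p i a)\<^sup>2 = (\<Sum>b<k. (cov i a j b)\<^sup>2 / p j b)" by simp
qed

lemma gain_nonneg: "0 \<le> gain i j" if "i < n" "j < n"
  unfolding gain_eq_cov[OF that] using that
  by (intro sum_nonneg divide_nonneg_nonneg) (auto simp: p_nonneg)

lemma gain_le_1: "gain i j \<le> 1" if "i < n" "j < n"
proof -
  have "gain i j \<le> (\<Sum>a<k. \<Sum>b<k. q i a j b)"
    unfolding gain_def
  proof (intro sum_mono)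
    fix a assume "a \<in> {..<k}"
    then have a: "a < k" by simp
    have "(\<Sum>b<k. (q i a j b)\<^sup>2 / p j b) \<le> (\<Sum>b<k. q i a j b)"
    proof (intro sum_mono)
      fix b assume "b \<in> {..<k}"
      then have b: "b < k" by simp
      have "q i a j b * q i a j b \<le> q i a j b * p j b"
        using q_le_right[OF that a b] q_nonneg[OF that a b] by (intro mult_left_mono)
      then show "(q i a j b)\<^sup>2 / p j b \<le> q i a j b"
        using p_nonneg[OF that(2) b] q_nonneg[OF that a b]
        by (cases "p j b = 0") (simp_all add: power2_eq_square divide_le_eq)
    qed
    then show "(\<Sum>b<k. (q i a j b)\<^sup>2 / p j b) - (p i a)\<^sup>2 \<le> (\<Sum>b<k. q i a j b)"
      by (smt (verit) zero_le_power2)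
  qed
  also have "\<dots> = 1" using that by (simp add: q_marginal p_sum)
  finally show ?thesis .
qed

lemma corr_le_gain: "corr i j \<le> (gain i j + gain j i) / 2" if "i < n" "j < n"
proof -
  have "corr i j \<le> (\<Sum>a<k. \<Sum>b<k. ((cov i a j b)\<^sup>2 / p j b + (cov i a j b)\<^sup>2 / p i a) / 2)"
    unfolding corr_def
  proof (intro sum_mono)
    fix a b assume "a \<in> {..<k}" "b \<in> {..<k}"
    then have ab: "a < k" "b < k" by simp_all
    show "(cov i a j b)\<^sup>2 / sqrt (p i a * p j b)
      \<le> ((cov i a j b)\<^sup>2 / p j b + (cov i a j b)\<^sup>2 / p i a) / 2"
    proof (cases "p i a = 0 \<or> p j b = 0")
      case True
      then show ?thesis using cov_eq_0[OF that ab True] by simp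
    next
      case False
      then have pos: "p i a > 0" "p j b > 0"
        using p_nonneg[OF that(1) ab(1)] p_nonneg[OF that(2) ab(2)] by auto
      \<comment> \<open>AM-GM for the reciprocals of the two probabilities; its two halves become
        the gains in the two directions.\<close>
      have "1 / sqrt (p i a * p j b) = sqrt ((1 / p i a) * (1 / p j b))"
        by (simp add: real_sqrt_divide real_sqrt_mult)
      also have "\<dots> \<le> (1 / p i a + 1 / p j b) / 2"
        using pos by (intro arith_geo_mean_sqrt) auto
      finally have "(cov i a j b)\<^sup>2 * (1 / sqrt (p i a * p j b))
        \<le> (cov i a j b)\<^sup>2 * ((1 / p i a + 1 / p j b) / 2)"
        by (intro mult_left_mono) auto
      then show ?thesis by (simp add: algebra_simps add_divide_distrib)
    qed
  qed
  also have "\<dots> = ((\<Sum>a<k. \<Sum>b<k. (cov i a j b)\<^sup>2 / p j b) + (\<Sum>a<k. \<Sum>b<k. (cov i a j b)\<^sup>2 / p i a)) / 2"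
    by (simp add: sum.distrib sum_divide_distrib add_divide_distrib)
  also have "(\<Sum>a<k. \<Sum>b<k. (cov i a j b)\<^sup>2 / p i a) = (\<Sum>b<k. \<Sum>a<k. (cov i a j b)\<^sup>2 / p i a)"
    by (rule sum.swap)
  also have "\<dots> = (\<Sum>b<k. \<Sum>a<k. (cov j b i a)\<^sup>2 / p i a)"
    using that by (intro sum.cong refl) (auto simp: cov_sym)
  finally show ?thesis using that by (simp add: gain_eq_cov)
qed

lemma corr_le_1: "corr i j \<le> 1" if "i < n" "j < n"
  using corr_le_gain[OF that] gain_le_1[OF that] gain_le_1[OF that(2,1)] by simp

text \<open>The component of \<open>U i a\<close> orthogonal to the unit vector \<open>U0\<close>,
  because their inner product is \<open>p i a\<close>.\<close>

definition centered :: "nat \<Rightarrow> nat \<Rightarrow> nat \<Rightarrow> real" where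
  "centered i a t = U i a t - p i a * U0 t"

lemma centered_gram: "(\<Sum>t<N. centered i a t * centered j b t) = cov i a j b"
  if "i < n" "j < n" "a < k" "b < k"
proof -
  have "(\<Sum>t<N. centered i a t * centered j b t) = (\<Sum>t<N. U i a t * U j b t)
    - p j b * (\<Sum>t<N. U i a t * U0 t) - p i a * (\<Sum>t<N. U j b t * U0 t)
    + p i a * p j b * (\<Sum>t<N. U0 t * U0 t)"
    by (simp add: centered_def sum.distrib sum_subtractf sum_distrib_left algebra_simps)
  then show ?thesis
    using that by (simp add: gram gram_base gram_base_base cov_def)
qed

text \<open>A squared inner product is the inner product of the tensor squares. So
  \<open>W i\<close> is the sum over \<open>a\<close> of the tensor squares of
  \<open>centered i a\<close>, scaled by \<open>1 / sqrt (p i a)\<close>, with coordinates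
  \<open>(s, t)\<close>.\<close>

lemma corr_gram:
  assumes "i < n" "j < n"
  defines "W \<equiv> \<lambda>i (s, t). \<Sum>a<k. centered i a s * centered i a t / sqrt (p i a)"
  shows "corr i j = (\<Sum>z\<in>{..<N} \<times> {..<N}. W i z * W j z)"
proof -
  let ?c = "\<lambda>i a s t. centered i a s * centered i a t / sqrt (p i a)"
  have "corr i j = (\<Sum>a<k. \<Sum>b<k. \<Sum>z\<in>{..<N} \<times> {..<N}. ?c i a (fst z) (snd z) * ?c j b (fst z) (snd z))"
    unfolding corr_def
  proof (intro sum.cong refl)
    fix a b assume "a \<in> {..<k}" "b \<in> {..<k}"
    then have ab: "a < k" "b < k" by simp_all
    have "(cov i a j b)\<^sup>2 = (\<Sum>s<N. \<Sum>t<N.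
        (centered i a s * centered j b s) * (centered i a t * centered j b t))"
      unfolding centered_gram[OF assms(1,2) ab, symmetric] power2_eq_square sum_product ..
    then have "(cov i a j b)\<^sup>2 / sqrt (p i a * p j b) = (\<Sum>s<N. \<Sum>t<N. ?c i a s t * ?c j b s t)"
      by (simp add: sum_divide_distrib real_sqrt_mult mult_ac)
    then show "(cov i a j b)\<^sup>2 / sqrt (p i a * p j b)
      = (\<Sum>z\<in>{..<N} \<times> {..<N}. ?c i a (fst z) (snd z) * ?c j b (fst z) (snd z))"
      by (simp only: sum.cartesian_product case_prod_unfold)
  qed
  also have "\<dots> = (\<Sum>a<k. \<Sum>z\<in>{..<N} \<times> {..<N}. \<Sum>b<k. ?c i a (fst z) (snd z) * ?c j b (fst z) (snd z))"
    by (intro sum.cong refl sum.swap)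
  also have "\<dots> = (\<Sum>z\<in>{..<N} \<times> {..<N}. \<Sum>a<k. \<Sum>b<k. ?c i a (fst z) (snd z) * ?c j b (fst z) (snd z))"
    by (rule sum.swap)
  finally show ?thesis
    by (simp only: W_def sum_product case_prod_unfold)
qed

text \<open>Independent sampling of \<open>X\<^sub>i\<close> and \<open>X\<^sub>j\<close> loses \<open>\<Sum>a. cov i a j (\<pi> a)\<close> on the constraint \<open>\<pi>\<close>.\<close>

lemma loss_squared_le_corr:
  assumes ij: "i < n" "j < n" and \<pi>: "\<pi> permutes {..<k}"
  shows "(\<Sum>a<k. cov i a j (\<pi> a))\<^sup>2 \<le> corr i j"
proof -
  have \<pi>k: "\<pi> a < k" if "a < k" for a
    using permutes_in_image[OF \<pi>, of a] that by simp
  \<comment> \<open>The weight for Cauchy-Schwarz. By AM-GM, and since \<open>\<pi>\<close> is a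
    bijection, its sum is at most the mean of two total probabilities, which is 1.\<close>
  define s where "s a = sqrt (p i a * p j (\<pi> a))" for a
  have s0: "0 \<le> s a" if "a < k" for a using that ij by (simp add: s_def p_nonneg \<pi>k)
  have s1: "cov i a j (\<pi> a) = 0" if "a < k" "s a = 0" for a
    using that ij cov_eq_0[of i j a "\<pi> a"] \<pi>k by (auto simp: s_def)
  have "(\<Sum>a<k. cov i a j (\<pi> a))\<^sup>2 = (\<Sum>a<k. (cov i a j (\<pi> a) / sqrt (s a)) * sqrt (s a))\<^sup>2"
    by (intro arg_cong[of _ _ "\<lambda>x. x\<^sup>2"] sum.cong refl) (auto simp: s1)
  also have "\<dots> \<le> (\<Sum>a<k. (cov i a j (\<pi> a) / sqrt (s a))\<^sup>2) * (\<Sum>a<k. (sqrt (s a))\<^sup>2)"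
    by (rule Cauchy_Schwarz_ineq_sum)
  also have "\<dots> = (\<Sum>a<k. (cov i a j (\<pi> a))\<^sup>2 / s a) * (\<Sum>a<k. s a)"
    using s0 by (simp add: power_divide)
  also have "\<dots> \<le> (\<Sum>a<k. (cov i a j (\<pi> a))\<^sup>2 / s a) * 1"
  proof (intro mult_left_mono sum_nonneg)
    have "(\<Sum>a<k. s a) \<le> (\<Sum>a<k. (p i a + p j (\<pi> a)) / 2)"
      unfolding s_def using ij by (intro sum_mono arith_geo_mean_sqrt) (auto simp: p_nonneg \<pi>k)
    also have "\<dots> = ((\<Sum>a<k. p i a) + (\<Sum>a<k. p j (\<pi> a))) / 2"
      by (simp add: sum.distrib sum_divide_distrib add_divide_distrib)
    also have "(\<Sum>a<k. p j (\<pi> a)) = (\<Sum>a<k. p j a)"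
      using sum.permute[OF \<pi>, of "p j"] by (simp add: o_def)
    finally show "(\<Sum>a<k. s a) \<le> 1" using ij by (simp add: p_sum)
  qed (use s0 in auto)
  \<comment> \<open>Label pairs not matched by \<open>\<pi>\<close> only add nonnegative
    terms.\<close>
  also have "\<dots> \<le> corr i j"
    unfolding corr_def mult_1_right
  proof (intro sum_mono)
    fix a assume "a \<in> {..<k}"
    then have a: "a < k" by simp
    show "(cov i a j (\<pi> a))\<^sup>2 / s a \<le> (\<Sum>b<k. (cov i a j b)\<^sup>2 / sqrt (p i a * p j b))"
      unfolding s_def using a ij \<pi>k
      by (intro member_le_sum[of "\<pi> a" _ "\<lambda>b. (cov i a j b)\<^sup>2 / sqrt (p i a * p j b)"])
        (auto simp: p_nonneg)
  qed
  finally show ?thesis .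
qed

end

section \<open>Lasserre solutions conditioned on a seed\<close>

lemma sum_prob_fibres:
  assumes "finite X" and "\<And>y. y \<in> set_pmf M \<Longrightarrow> f y \<in> X"
  shows "(\<Sum>x\<in>X. measure_pmf.prob M {y. f y = x \<and> Q y}) = measure_pmf.prob M {y. Q y}"
proof -
  have "(\<Sum>x\<in>X. measure_pmf.prob M {y. f y = x \<and> Q y})
    = measure_pmf.prob M (\<Union>x\<in>X. {y. f y = x \<and> Q y})"
    using assms(1) by (intro measure_pmf.finite_measure_finite_Union[symmetric])
      (auto simp: disjoint_family_on_def)
  also have "\<dots> = measure_pmf.prob M {y. Q y}"
    by (intro measure_pmf.finite_measure_eq_AE AE_pmfI) (auto dest: assms(2))
  finally show ?thesis .
qed

text \<open>The second hypothesis admits \<open>i\<close> in \<open>S\<close>: a constraint may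
  touch the seed, and then the update must leave \<open>x\<close> as it is.\<close>

lemma restrict_insert_eq_iff:
  assumes "x \<in> extensional S" and "i \<in> S \<Longrightarrow> a = x i"
  shows "restrict y (insert i S) = x(i := a) \<longleftrightarrow> restrict y S = x \<and> y i = a"
proof
  assume eq: "restrict y (insert i S) = x(i := a)"
  have val: "y l = (x(i := a)) l" if "l \<in> insert i S" for l
    using fun_cong[OF eq, of l] that by simp
  have "restrict y S = x"
  proof
    fix l show "restrict y S l = x l"
      using val[of l] assms by (cases "l \<in> S") (auto simp: extensional_def)
  qed
  moreover have "y i = a" using val[of i] by simp
  ultimately show "restrict y S = x \<and> y i = a" ..
next
  assume "restrict y S = x \<and> y i = a"
  then show "restrict y (insert i S) = x(i := a)" by (auto simp: restrict_def fun_eq_iff)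
qed

text \<open>Joint with the seed event and not divided by its probability, so that marginalization
  holds for seed labels of probability 0 too.\<close>

definition marg1 :: "local_dists \<Rightarrow> nat set \<Rightarrow> (nat \<Rightarrow> nat) \<Rightarrow> nat \<Rightarrow> nat \<Rightarrow> real" where
  "marg1 \<mu> S x i a = measure_pmf.prob (\<mu> (insert i S)) {y. restrict y S = x \<and> y i = a}"

definition marg2 :: "local_dists \<Rightarrow> nat set \<Rightarrow> (nat \<Rightarrow> nat) \<Rightarrow> nat \<Rightarrow> nat \<Rightarrow> nat \<Rightarrow> nat \<Rightarrow> real" where
  "marg2 \<mu> S x i a j b =
    measure_pmf.prob (\<mu> (insert i (insert j S))) {y. restrict y S = x \<and> y i = a \<and> y j = b}"

definition cond1 :: "local_dists \<Rightarrow> nat set \<Rightarrow> (nat \<Rightarrow> nat) \<Rightarrow> nat \<Rightarrow> nat \<Rightarrow> real" where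
  "cond1 \<mu> S x i a = marg1 \<mu> S x i a / pmf (\<mu> S) x"

definition cond2 :: "local_dists \<Rightarrow> nat set \<Rightarrow> (nat \<Rightarrow> nat) \<Rightarrow> nat \<Rightarrow> nat \<Rightarrow> nat \<Rightarrow> nat \<Rightarrow> real" where
  "cond2 \<mu> S x i a j b = marg2 \<mu> S x i a j b / pmf (\<mu> S) x"

lemma marg1_nonneg: "0 \<le> marg1 \<mu> S x i a"
  by (simp add: marg1_def)

lemma marg2_nonneg: "0 \<le> marg2 \<mu> S x i a j b"
  by (simp add: marg2_def)

lemma marg2_sym: "marg2 \<mu> S x i a j b = marg2 \<mu> S x j b i a"
  by (simp add: marg2_def insert_commute conj_commute)

locale lasserre =
  fixes n k r :: nat and \<mu> :: local_dists and v :: lasserre_vectors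
  assumes solution: "lasserre_solution n k r \<mu> v"
begin

lemma support: "set_pmf (\<mu> T) \<subseteq> T \<rightarrow>\<^sub>E {..<k}" if "T \<subseteq> {..<n}" "card T \<le> r + 2"
  using solution that by (auto simp: lasserre_solution_def local_distributions_def)

text \<open>The condition on \<open>Q\<close> says that the labels on \<open>S\<close> decide the
  event. Its probability is then determined by the restriction to \<open>S\<close>, where the two
  local distributions agree.\<close>

lemma consistent:
  assumes "S \<subseteq> T" "T \<subseteq> {..<n}" "card T \<le> r + 2" and Q: "\<And>y. Q y \<longleftrightarrow> Q (restrict y S)"
  shows "measure_pmf.prob (\<mu> T) {y. Q y} = measure_pmf.prob (\<mu> S) {y. Q y}"
proof -
  have "card S \<le> r + 2"
    using card_mono[OF finite_subset[OF assms(2)] assms(1)] assms(3) by simp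
  then have "map_pmf (\<lambda>x. restrict x (S \<inter> T)) (\<mu> S) = map_pmf (\<lambda>x. restrict x (S \<inter> T)) (\<mu> T)"
    using solution[unfolded lasserre_solution_def local_distributions_def,
        THEN conjunct1, THEN conjunct2, THEN spec, of S, THEN spec, of T]
      assms(1-3) order_trans[OF assms(1,2)]
    by simp
  moreover have "S \<inter> T = S" using assms(1) by blast
  ultimately have eq: "map_pmf (\<lambda>x. restrict x S) (\<mu> S) = map_pmf (\<lambda>x. restrict x S) (\<mu> T)" by simp

  show ?thesis
    using arg_cong[OF eq, of "\<lambda>M. measure_pmf.prob M {y. Q y}"] by (simp flip: Q)
qed

lemma pmf_eq_prob:
  assumes "S \<subseteq> {..<n}" "card S \<le> r + 2"
  shows "pmf (\<mu> S) x = measure_pmf.prob (\<mu> S) {y. restrict y S = x}"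
proof -
  have "restrict y S = y" if "y \<in> set_pmf (\<mu> S)" for y
    using support[OF assms] that by (auto simp: PiE_def intro: extensional_restrict)
  then have "measure_pmf.prob (\<mu> S) {y. restrict y S = x} = measure_pmf.prob (\<mu> S) {x}"
    by (intro measure_pmf.finite_measure_eq_AE AE_pmfI) auto
  then show ?thesis by (simp add: measure_pmf_single)
qed

context
  fixes S :: "nat set"
  assumes S: "S \<subseteq> {..<n}"
begin

lemma finite_S: "finite S"
  using S finite_subset by blast

lemma prob_fibres_labels:
  assumes "S \<subseteq> T" "T \<subseteq> {..<n}" "card T \<le> r + 2"
  shows "(\<Sum>x\<in>S \<rightarrow>\<^sub>E {..<k}. measure_pmf.prob (\<mu> T) {y. restrict y S = x \<and> Q y})
    = measure_pmf.prob (\<mu> T) {y. Q y}"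
proof (rule sum_prob_fibres)
  show "restrict y S \<in> S \<rightarrow>\<^sub>E {..<k}" if "y \<in> set_pmf (\<mu> T)" for y
    using support[OF assms(2,3)] that assms(1) by (auto simp: PiE_iff)
qed (intro finite_PiE finite_S, simp)

lemma pmf_eq_prob_superset:
  assumes "S \<subseteq> T" "T \<subseteq> {..<n}" "card T \<le> r + 2"
  shows "measure_pmf.prob (\<mu> T) {y. restrict y S = x} = pmf (\<mu> S) x"
proof -
  have "card S \<le> r + 2"
    using card_mono[OF finite_subset[OF assms(2)] assms(1)] assms(3) by simp
  then show ?thesis
    using consistent[OF assms, of "\<lambda>y. restrict y S = x"] S by (simp add: pmf_eq_prob Int_absorb)
qed

lemma marg1_eq_superset:
  assumes "insert i S \<subseteq> T" "T \<subseteq> {..<n}" "card T \<le> r + 2"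
  shows "measure_pmf.prob (\<mu> T) {y. restrict y S = x \<and> y i = a} = marg1 \<mu> S x i a"
  unfolding marg1_def
  by (rule consistent[OF assms]) (simp add: restrict_def if_distrib cong: if_cong)

lemma sum_marg2:
  assumes "i < n" "j < n" "card S \<le> r"
  shows "(\<Sum>b<k. marg2 \<mu> S x i a j b) = marg1 \<mu> S x i a"
proof -
  let ?T = "insert i (insert j S)"
  \<comment> \<open>The two ends of a constraint on top of a seed of at most \<open>r\<close>
    vertices use up the level \<open>r + 2\<close>.\<close>
  have T: "insert i S \<subseteq> ?T" "?T \<subseteq> {..<n}" "card ?T \<le> r + 2"
    using S assms finite_S by (auto simp: card_insert_if)
  have "(\<Sum>b<k. marg2 \<mu> S x i a j b)
    = (\<Sum>b<k. measure_pmf.prob (\<mu> ?T) {y. y j = b \<and> (restrict y S = x \<and> y i = a)})"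
    unfolding marg2_def by (intro sum.cong refl arg_cong2[where f = measure]) auto
  also have "\<dots> = measure_pmf.prob (\<mu> ?T) {y. restrict y S = x \<and> y i = a}"
    using support[OF T(2,3)] by (intro sum_prob_fibres) (auto simp: PiE_iff)
  also have "\<dots> = marg1 \<mu> S x i a" by (rule marg1_eq_superset[OF T])
  finally show ?thesis .
qed

lemma sum_marg1:
  assumes "i < n" "card S \<le> r + 1"
  shows "(\<Sum>a<k. marg1 \<mu> S x i a) = pmf (\<mu> S) x"
proof -
  let ?T = "insert i S"
  have T: "S \<subseteq> ?T" "?T \<subseteq> {..<n}" "card ?T \<le> r + 2"
    using S assms finite_S by (auto simp: card_insert_if)
  have "(\<Sum>a<k. marg1 \<mu> S x i a)
    = (\<Sum>a<k. measure_pmf.prob (\<mu> ?T) {y. y i = a \<and> restrict y S = x})"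
    unfolding marg1_def by (intro sum.cong refl arg_cong2[where f = measure]) auto
  also have "\<dots> = measure_pmf.prob (\<mu> ?T) {y. restrict y S = x}"
    using support[OF T(2,3)] by (intro sum_prob_fibres) (auto simp: PiE_iff)
  also have "\<dots> = pmf (\<mu> S) x" by (rule pmf_eq_prob_superset[OF T])
  finally show ?thesis .
qed

lemma sum_pmf_labels:
  assumes "card S \<le> r + 2"
  shows "(\<Sum>x\<in>S \<rightarrow>\<^sub>E {..<k}. pmf (\<mu> S) x) = 1"
  using support[OF S assms] by (intro sum_pmf_eq_1 finite_PiE finite_S) auto

lemma marg1_le_pmf:
  assumes "i < n" "card S \<le> r + 1"
  shows "marg1 \<mu> S x i a \<le> pmf (\<mu> S) x"
proof -
  have T: "S \<subseteq> insert i S" "insert i S \<subseteq> {..<n}" "card (insert i S) \<le> r + 2"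
    using S assms finite_S by (auto simp: card_insert_if)
  show ?thesis
    unfolding pmf_eq_prob_superset[OF T, symmetric] marg1_def
    by (intro measure_pmf.finite_measure_mono) auto
qed

lemma marg1_mem:
  assumes "i \<in> S" "card S \<le> r + 2"
  shows "marg1 \<mu> S x i a = (if a = x i then pmf (\<mu> S) x else 0)"
proof -
  have iS: "insert i S = S" using assms by blast
  have "{y. restrict y S = x \<and> y i = a} = (if a = x i then {y. restrict y S = x} else {})"
    using assms(1) by auto
  then show ?thesis
    unfolding marg1_def iS using S assms(2) by (simp add: pmf_eq_prob)
qed

lemma marg2_mem:
  assumes "j \<in> S"
  shows "marg2 \<mu> S x i a j b = (if b = x j then marg1 \<mu> S x i a else 0)"
proof -
  have jS: "insert j S = S" using assms by blast
  have "{y. restrict y S = x \<and> y i = a \<and> y j = b}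
    = (if b = x j then {y. restrict y S = x \<and> y i = a} else {})"
    using assms by auto
  then show ?thesis unfolding marg2_def marg1_def jS by simp
qed

lemma marg2_diag: "marg2 \<mu> S x i a i b = (if a = b then marg1 \<mu> S x i a else 0)"
proof -
  have "{y. restrict y S = x \<and> y i = a \<and> y i = b}
    = (if a = b then {y. restrict y S = x \<and> y i = a} else {})"
    by auto
  then show ?thesis unfolding marg2_def marg1_def by simp
qed

lemma marg1_insert:
  assumes "x \<in> S \<rightarrow>\<^sub>E {..<k}" "j \<notin> S"
  shows "marg1 \<mu> (insert j S) (x(j := b)) i a = marg2 \<mu> S x i a j b"
proof -
  have "restrict y (insert j S) = x(j := b) \<longleftrightarrow> restrict y S = x \<and> y j = b" for y
    using assms by (intro restrict_insert_eq_iff) (auto simp: PiE_iff)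
  then show ?thesis unfolding marg1_def marg2_def
    by (intro arg_cong2[where f = measure]) auto
qed

lemma pmf_insert:
  assumes "x \<in> S \<rightarrow>\<^sub>E {..<k}" "j \<notin> S" "j < n" "card S \<le> r + 1"
  shows "pmf (\<mu> (insert j S)) (x(j := b)) = marg1 \<mu> S x j b"
proof -
  have "restrict y (insert j S) = x(j := b) \<longleftrightarrow> restrict y S = x \<and> y j = b" for y
    using assms by (intro restrict_insert_eq_iff) (auto simp: PiE_iff)
  then show ?thesis unfolding marg1_def
    using S assms finite_S by (subst pmf_eq_prob) (auto simp: card_insert_if)
qed

text \<open>Both labelled sets extend the same labelled seed, so their joint event is the seed event
  together with the two labels. The label of a seed vertex must be the one in \<open>x\<close>,
  since \<open>x(i := a)\<close> would otherwise describe another seed event.\<close>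

lemma vector_product:
  assumes "i < n" "j < n" "card S \<le> r" and x: "x \<in> S \<rightarrow>\<^sub>E {..<k}"
    and ab: "a < k" "b < k" "i \<in> S \<Longrightarrow> a = x i" "j \<in> S \<Longrightarrow> b = x j"
  shows "scalar_prod (v (insert i S) (x(i := a))) (v (insert j S) (x(j := b)))
    = marg2 \<mu> S x i a j b"
proof -
  have U: "insert i S \<union> insert j S = insert i (insert j S)" by auto
  have sub: "insert i S \<subseteq> {..<n}" "insert j S \<subseteq> {..<n}" using S assms by auto
  have card: "card (insert i (insert j S)) \<le> r + 2"
    using assms finite_S by (auto simp: card_insert_if)
  have lab: "x(i := a) \<in> insert i S \<rightarrow>\<^sub>E {..<k}" "x(j := b) \<in> insert j S \<rightarrow>\<^sub>E {..<k}"
    using x ab by (auto simp: PiE_iff extensional_def)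
  have "scalar_prod (v (insert i S) (x(i := a))) (v (insert j S) (x(j := b)))
    = joint_prob \<mu> (insert i S) (x(i := a)) (insert j S) (x(j := b))"
    using solution sub card lab U unfolding lasserre_solution_def by simp
  moreover have "restrict y (insert i S) = x(i := a) \<and> restrict y (insert j S) = x(j := b)
    \<longleftrightarrow> restrict y S = x \<and> y i = a \<and> y j = b" for y
    using restrict_insert_eq_iff[of x S i a y] restrict_insert_eq_iff[of x S j b y] x ab
    by (auto simp: PiE_iff)
  ultimately show ?thesis unfolding joint_prob_def marg2_def U by simp
qed

lemma vector_product_base:
  assumes "i < n" "card S \<le> r" and x: "x \<in> S \<rightarrow>\<^sub>E {..<k}" and a: "a < k" "i \<in> S \<Longrightarrow> a = x i"
  shows "scalar_prod (v (insert i S) (x(i := a))) (v S x) = marg1 \<mu> S x i a"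
proof -
  have U: "insert i S \<union> S = insert i S" by auto
  have sub: "insert i S \<subseteq> {..<n}" using S assms by auto
  have card: "card (insert i S) \<le> r + 2"
    using assms finite_S by (auto simp: card_insert_if)
  have lab: "x(i := a) \<in> insert i S \<rightarrow>\<^sub>E {..<k}"
    using x a by (auto simp: PiE_iff extensional_def)
  have "scalar_prod (v (insert i S) (x(i := a))) (v S x)
    = joint_prob \<mu> (insert i S) (x(i := a)) S x"
    using solution S sub card lab U x unfolding lasserre_solution_def by simp
  moreover have "restrict y (insert i S) = x(i := a) \<and> restrict y S = x
    \<longleftrightarrow> restrict y S = x \<and> y i = a" for y
    using restrict_insert_eq_iff[of x S i a y] x a by (auto simp: PiE_iff)
  ultimately show ?thesis unfolding joint_prob_def marg1_def U by simp
qed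

lemma vector_product_base_base:
  assumes "card S \<le> r" and x: "x \<in> S \<rightarrow>\<^sub>E {..<k}"
  shows "scalar_prod (v S x) (v S x) = pmf (\<mu> S) x"
proof -
  have "scalar_prod (v S x) (v S x) = joint_prob \<mu> S x S x"
    using solution S assms unfolding lasserre_solution_def by simp
  then show ?thesis unfolding joint_prob_def using S assms by (simp add: pmf_eq_prob)
qed

text \<open>The vectors that extend \<open>(S, x)\<close>, divided by the square root of the
  probability of \<open>x\<close>, represent the conditional pair probabilities; the vector of
  \<open>(S, x)\<close>, scaled alike, is the base vector.\<close>

lemma conditional_pairwise_distribution:
  assumes card: "card S \<le> r" and x: "x \<in> set_pmf (\<mu> S)"
  obtains N U U0 where "pairwise_distribution n k N (cond1 \<mu> S x) (cond2 \<mu> S x) U U0"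
proof -
  obtain N where N: "\<And>S \<alpha>. v S \<alpha> \<in> carrier_vec N"
    using solution by (auto simp: lasserre_solution_def)
  have xS: "x \<in> S \<rightarrow>\<^sub>E {..<k}" using support[OF S] card x by auto
  define P where "P = pmf (\<mu> S) x"
  have P: "P > 0" using x by (simp add: P_def pmf_positive_iff)
  \<comment> \<open>Labels that contradict \<open>x\<close> on the seed have conditional probability
    0 and get the zero vector.\<close>
  define U where "U i a t = (if i \<in> S \<and> a \<noteq> x i then 0
    else vec_index (v (insert i S) (x(i := a))) t / sqrt P)" for i a t
  define U0 where "U0 t = vec_index (v S x) t / sqrt P" for t
  have sp: "(\<Sum>t<N. vec_index (v A \<alpha>) t / sqrt P * (vec_index (v B \<beta>) t / sqrt P))
      = scalar_prod (v A \<alpha>) (v B \<beta>) / P" for A B \<alpha> \<beta>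
  proof -
    have "scalar_prod (v A \<alpha>) (v B \<beta>) = (\<Sum>t<N. vec_index (v A \<alpha>) t * vec_index (v B \<beta>) t)"
      using N[of B \<beta>] by (simp add: scalar_prod_def atLeast0LessThan)
    then show ?thesis using P by (simp add: sum_divide_distrib)
  qed
  have "pairwise_distribution n k N (cond1 \<mu> S x) (cond2 \<mu> S x) U U0"
  proof
    fix i j a b assume ij: "i < n" "j < n" and ab: "a < k" "b < k"
    show "0 \<le> cond2 \<mu> S x i a j b" by (simp add: cond2_def marg2_nonneg)
    show "cond2 \<mu> S x i a j b = cond2 \<mu> S x j b i a" by (simp add: cond2_def marg2_sym)
    show "(\<Sum>t<N. U i a t * U j b t) = cond2 \<mu> S x i a j b"
    proof (cases "(i \<in> S \<and> a \<noteq> x i) \<or> (j \<in> S \<and> b \<noteq> x j)")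
      case True
      then have "marg2 \<mu> S x i a j b = 0"
        using marg2_mem[of j x i a b] marg2_mem[of i x j b a] marg2_sym[of \<mu> S x i a j b] by auto
      then show ?thesis using True by (auto simp: U_def cond2_def)
    next
      case False
      then have "(\<Sum>t<N. U i a t * U j b t)
        = scalar_prod (v (insert i S) (x(i := a))) (v (insert j S) (x(j := b))) / P"
        unfolding sp[symmetric] by (intro sum.cong refl) (auto simp: U_def)
      then show ?thesis using False ij ab xS card
        by (subst (asm) vector_product) (auto simp: cond2_def P_def)
    qed
  next
    fix i j a assume "i < n" "j < n" "a < k"
    then show "(\<Sum>b<k. cond2 \<mu> S x i a j b) = cond1 \<mu> S x i a"
      using card by (simp add: cond1_def cond2_def sum_marg2 flip: sum_divide_distrib)
  next
    fix i assume "i < n"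
    then show "(\<Sum>a<k. cond1 \<mu> S x i a) = 1"
      using card P by (simp add: cond1_def sum_marg1 P_def flip: sum_divide_distrib)
  next
    fix i a assume ia: "i < n" "a < k"
    show "(\<Sum>t<N. U i a t * U0 t) = cond1 \<mu> S x i a"
    proof (cases "i \<in> S \<and> a \<noteq> x i")
      case True
      then show ?thesis using card by (simp add: U_def cond1_def marg1_mem)
    next
      case False
      then have "(\<Sum>t<N. U i a t * U0 t)
        = scalar_prod (v (insert i S) (x(i := a))) (v S x) / P"
        unfolding sp[symmetric] by (intro sum.cong refl) (auto simp: U_def U0_def)
      then show ?thesis using False ia xS card
        by (subst (asm) vector_product_base) (auto simp: cond1_def P_def)
    qed
  next
    show "(\<Sum>t<N. U0 t * U0 t) = 1"
      unfolding U0_def sp using card xS P by (simp add: vector_product_base_base P_def)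
  qed
  then show ?thesis by (rule that)
qed

end

section \<open>The collision potential and its increase when one more vertex is conditioned
  on\<close>

abbreviation labels :: "nat set \<Rightarrow> (nat \<Rightarrow> nat) set" where
  "labels S \<equiv> S \<rightarrow>\<^sub>E {..<k}"

abbreviation cgain :: "nat set \<Rightarrow> (nat \<Rightarrow> nat) \<Rightarrow> nat \<Rightarrow> nat \<Rightarrow> real" where
  "cgain S x \<equiv> pairwise_distribution.gain k (cond1 \<mu> S x) (cond2 \<mu> S x)"

text \<open>The expected collision probability of \<open>X\<^sub>i\<close> given \<open>X\<^sub>S\<close>, summed over \<open>i\<close>.\<close>

definition potential :: "nat set \<Rightarrow> real" where
  "potential S = (\<Sum>i<n. \<Sum>x\<in>labels S. \<Sum>a<k. (marg1 \<mu> S x i a)\<^sup>2 / pmf (\<mu> S) x)"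

lemma potential_nonneg: "0 \<le> potential S"
  unfolding potential_def by (intro sum_nonneg divide_nonneg_nonneg) auto

lemma potential_le:
  assumes S: "S \<subseteq> {..<n}" and card: "card S \<le> r + 1"
  shows "potential S \<le> n"
proof -
  have "potential S \<le> (\<Sum>i<n. \<Sum>x\<in>labels S. \<Sum>a<k. marg1 \<mu> S x i a)"
    unfolding potential_def
  proof (intro sum_mono)
    fix i x a assume "i \<in> {..<n}"
    then have i: "i < n" by simp
    have "marg1 \<mu> S x i a * marg1 \<mu> S x i a \<le> marg1 \<mu> S x i a * pmf (\<mu> S) x"
      using marg1_le_pmf[OF S i card] marg1_nonneg by (intro mult_left_mono)
    then show "(marg1 \<mu> S x i a)\<^sup>2 / pmf (\<mu> S) x \<le> marg1 \<mu> S x i a"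
      using marg1_nonneg by (cases "pmf (\<mu> S) x = 0") (simp_all add: power2_eq_square divide_le_eq)
  qed
  also have "\<dots> = n"
    using sum_pmf_labels[OF S] sum_marg1[OF S] card by simp
  finally show ?thesis .
qed

lemma sum_labels_insert:
  assumes "finite S" "j \<notin> S"
  shows "(\<Sum>x\<in>labels (insert j S). f x) = (\<Sum>x\<in>labels S. \<Sum>b<k. f (x(j := b)))"
proof -
  have "(\<Sum>x\<in>labels (insert j S). f x) = (\<Sum>(b, x)\<in>{..<k} \<times> labels S. f (x(j := b)))"
    unfolding PiE_insert_eq using inj_combinator[OF assms(2), of "\<lambda>_. {..<k}"]
    by (subst sum.reindex) (auto simp: case_prod_unfold)
  also have "\<dots> = (\<Sum>b<k. \<Sum>x\<in>labels S. f (x(j := b)))"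
    by (simp add: sum.cartesian_product)
  also have "\<dots> = (\<Sum>x\<in>labels S. \<Sum>b<k. f (x(j := b)))"
    by (rule sum.swap)
  finally show ?thesis .
qed

text \<open>One formula for new and for repeated vertices. Outside \<open>S\<close>, the labels of
  the larger set are the old ones extended by \<open>b\<close>; inside, only \<open>b = x j\<close>
  survives and the potential stays the same.\<close>

lemma potential_insert:
  assumes S: "S \<subseteq> {..<n}" and card: "card S \<le> r" and j: "j < n"
  shows "potential (insert j S)
    = (\<Sum>i<n. \<Sum>x\<in>labels S. \<Sum>a<k. \<Sum>b<k. (marg2 \<mu> S x i a j b)\<^sup>2 / marg1 \<mu> S x j b)"
proof (cases "j \<in> S")
  case True
  then have jS: "insert j S = S" by blast
  show ?thesis
    unfolding potential_def jS
  proof (intro sum.cong refl)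
    fix i x a assume "x \<in> labels S"
    then have xj: "x j < k" using True by (auto simp: PiE_iff)
    have "(\<Sum>b<k. (marg2 \<mu> S x i a j b)\<^sup>2 / marg1 \<mu> S x j b)
      = (\<Sum>b<k. if b = x j then (marg1 \<mu> S x i a)\<^sup>2 / pmf (\<mu> S) x else 0)"
      using card by (intro sum.cong refl) (simp add: marg2_mem[OF S True] marg1_mem[OF S True])
    then show "(marg1 \<mu> S x i a)\<^sup>2 / pmf (\<mu> S) x
      = (\<Sum>b<k. (marg2 \<mu> S x i a j b)\<^sup>2 / marg1 \<mu> S x j b)"
      using xj by simp
  qed
next
  case False
  show ?thesis
    unfolding potential_def
  proof (rule sum.cong[OF refl])
    fix i
    have "(\<Sum>x\<in>labels (insert j S). \<Sum>a<k. (marg1 \<mu> (insert j S) x i a)\<^sup>2 / pmf (\<mu> (insert j S)) x)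
      = (\<Sum>x\<in>labels S. \<Sum>b<k. \<Sum>a<k.
          (marg1 \<mu> (insert j S) (x(j := b)) i a)\<^sup>2 / pmf (\<mu> (insert j S)) (x(j := b)))"
      by (rule sum_labels_insert[OF finite_S[OF S] False])
    also have "\<dots> = (\<Sum>x\<in>labels S. \<Sum>b<k. \<Sum>a<k. (marg2 \<mu> S x i a j b)\<^sup>2 / marg1 \<mu> S x j b)"
      using card j False
      by (intro sum.cong refl) (simp add: marg1_insert[OF S] pmf_insert[OF S])
    also have "\<dots> = (\<Sum>x\<in>labels S. \<Sum>a<k. \<Sum>b<k. (marg2 \<mu> S x i a j b)\<^sup>2 / marg1 \<mu> S x j b)"
      by (intro sum.cong refl sum.swap)
    finally show "(\<Sum>x\<in>labels (insert j S). \<Sum>a<k. (marg1 \<mu> (insert j S) x i a)\<^sup>2 / pmf (\<mu> (insert j S)) x)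
      = (\<Sum>x\<in>labels S. \<Sum>a<k. \<Sum>b<k. (marg2 \<mu> S x i a j b)\<^sup>2 / marg1 \<mu> S x j b)" .
  qed
qed

text \<open>Multiplying by the probability of \<open>x\<close> turns the conditional quotients in
  the gain into the quotients of joint probabilities in the potentials.\<close>

lemma potential_increase:
  assumes S: "S \<subseteq> {..<n}" and card: "card S \<le> r" and j: "j < n"
  shows "potential (insert j S) - potential S
    = (\<Sum>i<n. \<Sum>x\<in>labels S. pmf (\<mu> S) x * cgain S x i j)"
proof -
  have "(\<Sum>a<k. \<Sum>b<k. (marg2 \<mu> S x i a j b)\<^sup>2 / marg1 \<mu> S x j b)
      - (\<Sum>a<k. (marg1 \<mu> S x i a)\<^sup>2 / pmf (\<mu> S) x) = pmf (\<mu> S) x * cgain S x i j"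
    if i: "i < n" and x: "x \<in> labels S" for i x
  proof (cases "pmf (\<mu> S) x = 0")
    \<comment> \<open>For impossible seed labels all denominators are 0, so every quotient is 0, and
      the gain is multiplied by 0.\<close>
    case True
    have "marg1 \<mu> S x j b = 0" for b
      using marg1_le_pmf[OF S j, of x b] marg1_nonneg[of \<mu> S x j b] card True by simp
    then show ?thesis using True by simp
  next
    case False
    then have "x \<in> set_pmf (\<mu> S)" by (simp add: set_pmf_iff)
    then obtain N U U0 where "pairwise_distribution n k N (cond1 \<mu> S x) (cond2 \<mu> S x) U U0"
      using conditional_pairwise_distribution[OF S card] by blast
    then interpret pairwise_distribution n k N "cond1 \<mu> S x" "cond2 \<mu> S x" U U0 .
    have "pmf (\<mu> S) x * ((cond2 \<mu> S x i a j b)\<^sup>2 / cond1 \<mu> S x j b)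
        = (marg2 \<mu> S x i a j b)\<^sup>2 / marg1 \<mu> S x j b"
      and "pmf (\<mu> S) x * (cond1 \<mu> S x i a)\<^sup>2 = (marg1 \<mu> S x i a)\<^sup>2 / pmf (\<mu> S) x" for a b
      using False by (simp_all add: cond1_def cond2_def power2_eq_square)
    then show ?thesis
      unfolding gain_def by (simp only: sum_distrib_left right_diff_distrib sum_subtractf)
  qed
  then show ?thesis
    unfolding potential_insert[OF assms] unfolding potential_def
    by (simp flip: sum_subtractf)
qed

section \<open>Averages over seed tuples of a given length\<close>

definition tuples :: "nat \<Rightarrow> nat list set" where
  "tuples m = {s. set s \<subseteq> {..<n} \<and> length s = m}"

definition mean_potential :: "nat \<Rightarrow> real" where
  "mean_potential m = (\<Sum>s\<in>tuples m. potential (set s)) / n ^ m"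

lemma finite_tuples: "finite (tuples m)"
  by (simp add: tuples_def finite_lists_length_eq)

lemma card_tuples: "card (tuples m) = n ^ m"
  using card_lists_length_eq[of "{..<n}" m] by (simp add: tuples_def)

lemma tuples_set:
  assumes "s \<in> tuples m"
  shows "set s \<subseteq> {..<n}" "card (set s) \<le> m"
  using assms card_length[of s] by (auto simp: tuples_def)

lemma sum_tuples_Suc: "(\<Sum>s\<in>tuples (Suc m). f s) = (\<Sum>s\<in>tuples m. \<Sum>j<n. f (j # s))"
proof -
  have "tuples (Suc m) = (\<lambda>(s, j). j # s) ` (tuples m \<times> {..<n})"
    unfolding tuples_def by (rule lists_length_Suc_eq)
  then show ?thesis
    by (simp add: sum.reindex inj_on_def case_prod_unfold sum.cartesian_product)
qed

text \<open>As repetitions are allowed, a uniform \<open>m\<close>-tuple and a further uniform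
  vertex form a uniform tuple of length \<open>m + 1\<close>, so the increases add up to an exact
  difference of means. The factor \<open>n\<close> arises because the new vertex is summed over, not
  averaged.\<close>

lemma mean_potential_step:
  assumes "n > 0" "m \<le> r"
  shows "(\<Sum>s\<in>tuples m. \<Sum>x\<in>labels (set s). pmf (\<mu> (set s)) x * (\<Sum>i<n. \<Sum>j<n. cgain (set s) x i j)) / n ^ m
    = n * (mean_potential (Suc m) - mean_potential m)"
proof -
  have step: "(\<Sum>x\<in>labels (set s). pmf (\<mu> (set s)) x * (\<Sum>i<n. \<Sum>j<n. cgain (set s) x i j))
    = (\<Sum>j<n. potential (set (j # s))) - n * potential (set s)" if s: "s \<in> tuples m" for s
  proof -
    let ?S = "set s"
    have S: "?S \<subseteq> {..<n}" "card ?S \<le> r" using tuples_set[OF s] assms by auto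
    have "(\<Sum>x\<in>labels ?S. pmf (\<mu> ?S) x * (\<Sum>i<n. \<Sum>j<n. cgain ?S x i j))
      = (\<Sum>x\<in>labels ?S. \<Sum>i<n. \<Sum>j<n. pmf (\<mu> ?S) x * cgain ?S x i j)"
      by (simp add: sum_distrib_left)
    also have "\<dots> = (\<Sum>i<n. \<Sum>x\<in>labels ?S. \<Sum>j<n. pmf (\<mu> ?S) x * cgain ?S x i j)"
      by (rule sum.swap)
    also have "\<dots> = (\<Sum>i<n. \<Sum>j<n. \<Sum>x\<in>labels ?S. pmf (\<mu> ?S) x * cgain ?S x i j)"
      by (intro sum.cong refl sum.swap)
    also have "\<dots> = (\<Sum>j<n. \<Sum>i<n. \<Sum>x\<in>labels ?S. pmf (\<mu> ?S) x * cgain ?S x i j)"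
      by (rule sum.swap)
    also have "\<dots> = (\<Sum>j<n. potential (insert j ?S) - potential ?S)"
      using potential_increase[OF S] by simp
    finally show ?thesis by (simp add: sum_subtractf)
  qed
  have "(\<Sum>s\<in>tuples m. \<Sum>x\<in>labels (set s). pmf (\<mu> (set s)) x * (\<Sum>i<n. \<Sum>j<n. cgain (set s) x i j))
    = (\<Sum>s\<in>tuples (Suc m). potential (set s)) - n * (\<Sum>s\<in>tuples m. potential (set s))"
    unfolding sum_tuples_Suc using sum.cong[OF refl step]
    by (simp add: sum_subtractf sum_distrib_left)
  note eq = this
  show ?thesis
    unfolding mean_potential_def eq using assms(1) by (simp add: field_simps)
qed

text \<open>Lengths up to \<open>r + 1\<close> are covered because the last telescoping difference
  reaches \<open>Suc r\<close>.\<close>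

lemma mean_potential_bounds:
  assumes "n > 0" "m \<le> r + 1"
  shows "0 \<le> mean_potential m" "mean_potential m \<le> n"
proof -
  show "0 \<le> mean_potential m"
    unfolding mean_potential_def by (intro divide_nonneg_nonneg sum_nonneg potential_nonneg) auto
  have "(\<Sum>s\<in>tuples m. potential (set s)) \<le> (\<Sum>s\<in>tuples m. real n)"
  proof (intro sum_mono potential_le)
    fix s assume "s \<in> tuples m"
    then show "set s \<subseteq> {..<n}" "card (set s) \<le> r + 1"
      using tuples_set[of s m] assms(2) by auto
  qed
  then show "mean_potential m \<le> n"
    using assms(1) by (simp add: mean_potential_def card_tuples divide_le_eq mult.commute)
qed

end

section \<open>Propagation Sampling\<close>

lemma expectation_square_le:
  fixes f :: "'a \<Rightarrow> real"
  assumes "finite (set_pmf M)"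
  shows "(measure_pmf.expectation M f)\<^sup>2 \<le> measure_pmf.expectation M (\<lambda>x. (f x)\<^sup>2)"
  using measure_pmf.variance_eq[of M f] measure_pmf.variance_positive[of M f]
  by (simp add: integrable_measure_pmf_finite[OF assms])

lemma expectation_swap:
  fixes f :: "'a \<Rightarrow> 'b \<Rightarrow> real"
  assumes "finite (set_pmf M)" "finite (set_pmf M')"
  shows "measure_pmf.expectation M (\<lambda>x. measure_pmf.expectation M' (f x))
    = measure_pmf.expectation M' (\<lambda>y. measure_pmf.expectation M (\<lambda>x. f x y))"
proof -
  have M: "measure_pmf.expectation M g = (\<Sum>x\<in>set_pmf M. g x * pmf M x)" for g :: "'a \<Rightarrow> real"
    by (rule integral_measure_pmf_real[OF assms(1)])
  have M': "measure_pmf.expectation M' g = (\<Sum>x\<in>set_pmf M'. g x * pmf M' x)" for g :: "'b \<Rightarrow> real"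
    by (rule integral_measure_pmf_real[OF assms(2)])
  show ?thesis
    unfolding M M' sum_distrib_right by (subst sum.swap) (simp add: mult_ac)
qed

text \<open>The choices of Propagation Sampling up to the labels of the seed. The tuple is reduced
  to its set, as the later choices depend on nothing else.\<close>

definition seed :: "nat \<Rightarrow> nat \<Rightarrow> local_dists \<Rightarrow> (nat set \<times> (nat \<Rightarrow> nat)) pmf" where
  "seed n r \<mu> = do {
     m \<leftarrow> pmf_of_set {1..r};
     s \<leftarrow> pmf_of_set {s. set s \<subseteq> {..<n} \<and> length s = m};
     a \<leftarrow> \<mu> (set s);
     return_pmf (set s, a)
   }"

definition cond_label :: "local_dists \<Rightarrow> nat set \<Rightarrow> (nat \<Rightarrow> nat) \<Rightarrow> nat \<Rightarrow> nat pmf" where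
  "cond_label \<mu> S a i = map_pmf (\<lambda>x. x i) (cond_pmf (\<mu> (insert i S)) {x. restrict x S = a})"

definition propagate :: "nat \<Rightarrow> local_dists \<Rightarrow> nat set \<Rightarrow> (nat \<Rightarrow> nat) \<Rightarrow> (nat \<Rightarrow> nat) pmf" where
  "propagate n \<mu> S a = map_pmf (\<lambda>b i. if i \<in> S then a i else b i)
     (Pi_pmf ({..<n} - S) undefined (cond_label \<mu> S a))"

lemma propagation_sampling_eq_bind:
  "propagation_sampling n r \<mu> = seed n r \<mu> \<bind> (\<lambda>(S, a). propagate n \<mu> S a)"
  by (simp add: propagation_sampling_def seed_def propagate_def cond_label_def[abs_def]
      map_pmf_def[of "\<lambda>b i. if i \<in> _ then _ i else b i"] bind_assoc_pmf bind_return_pmf Let_def)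

lemma prob_two_coordinates:
  fixes i j n :: nat
  assumes "i < n" "j < n" "i \<noteq> j"
  shows "measure_pmf.prob (Pi_pmf {..<n} d \<nu>) {y. y i = a \<and> y j = b} = pmf (\<nu> i) a * pmf (\<nu> j) b"
proof -
  define B where "B l = (if l = i then {a} else if l = j then {b} else UNIV)" for l
  have "{y. y i = a \<and> y j = b} = Pi {..<n} B"
    using assms by (auto simp: B_def Pi_def split: if_splits)
  then have "measure_pmf.prob (Pi_pmf {..<n} d \<nu>) {y. y i = a \<and> y j = b}
    = (\<Prod>l<n. measure_pmf.prob (\<nu> l) (B l))"
    by (simp add: measure_Pi_pmf_Pi)
  also have "\<dots> = (\<Prod>l\<in>{i, j}. measure_pmf.prob (\<nu> l) (B l))"
    using assms by (intro prod.mono_neutral_right) (auto simp: B_def)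
  also have "\<dots> = pmf (\<nu> i) a * pmf (\<nu> j) b"
    using assms by (simp add: B_def measure_pmf_single)
  finally show ?thesis .
qed

section \<open>The law of the seed, and of the output given the seed\<close>

context lasserre
begin

lemma tuples_nonempty: "n > 0 \<Longrightarrow> tuples m \<noteq> {}"
  using card_tuples[of m] by force

lemma finite_support: "finite (set_pmf (\<mu> S))" if "S \<subseteq> {..<n}" "card S \<le> r + 2"
  by (rule finite_subset[OF support[OF that]]) (intro finite_PiE finite_S[OF that(1)], simp)

lemma seed_support:
  assumes "n > 0" "r > 0" "(S, x) \<in> set_pmf (seed n r \<mu>)"
  shows "S \<subseteq> {..<n}" "card S \<le> r" "x \<in> set_pmf (\<mu> S)"
proof -
  obtain m s where "m \<in> {1..r}" "s \<in> tuples m" "S = set s" "x \<in> set_pmf (\<mu> S)"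
    using assms(2,3) tuples_nonempty[OF assms(1)] finite_tuples
    by (auto simp: seed_def tuples_def[symmetric])
  then show "S \<subseteq> {..<n}" "card S \<le> r" "x \<in> set_pmf (\<mu> S)"
    using tuples_set[of s m] by auto
qed

lemma finite_seed:
  assumes "n > 0" "r > 0"
  shows "finite (set_pmf (seed n r \<mu>))"
proof (rule finite_subset)
  show "set_pmf (seed n r \<mu>) \<subseteq> (SIGMA S:{S. S \<subseteq> {..<n} \<and> card S \<le> r}. set_pmf (\<mu> S))"
    using seed_support[OF assms] by auto
qed (auto intro!: finite_support finite_subset[of _ "Pow {..<n}"])

text \<open>Impossible labels have weight 0, so the sum may run over all labellings; in this form it
  matches \<open>mean_potential_step\<close>.\<close>

lemma seed_expectation:
  fixes h :: "nat set \<times> (nat \<Rightarrow> nat) \<Rightarrow> real"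
  assumes "n > 0" "r > 0"
  shows "measure_pmf.expectation (seed n r \<mu>) h
    = (\<Sum>m=1..r. (\<Sum>s\<in>tuples m. \<Sum>x\<in>labels (set s). pmf (\<mu> (set s)) x * h (set s, x)) / n ^ m) / r"
proof -
  let ?f = "\<lambda>s. \<mu> (set s) \<bind> (\<lambda>a. return_pmf (set s, a))"
  have fin: "finite (set_pmf (?f s))" if "s \<in> tuples m" "m \<in> {1..r}" for s m
    using finite_support[of "set s"] tuples_set[OF that(1)] that(2) by simp
  have set_tuples: "set_pmf (pmf_of_set (tuples m)) = tuples m" for m
    using finite_tuples tuples_nonempty[OF assms(1)] by simp
  have inner: "measure_pmf.expectation (?f s) h = (\<Sum>x\<in>labels (set s). pmf (\<mu> (set s)) x * h (set s, x))"
    if "s \<in> tuples m" "m \<in> {1..r}" for s m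
    using support[of "set s"] tuples_set[OF that(1)] that(2)
    by (subst pmf_expectation_bind[of "labels (set s)"]) (auto intro!: finite_PiE)
  have "measure_pmf.expectation (seed n r \<mu>) h
    = (\<Sum>m\<in>{1..r}. measure_pmf.expectation (pmf_of_set (tuples m) \<bind> ?f) h / r)"
    unfolding seed_def tuples_def[symmetric] using assms(2) set_tuples finite_tuples fin
    by (subst pmf_expectation_bind_pmf_of_set) (auto simp: divide_inverse_commute)
  also have "\<dots> = (\<Sum>m=1..r. (\<Sum>s\<in>tuples m. measure_pmf.expectation (?f s) h) / n ^ m) / r"
    unfolding sum_divide_distrib using finite_tuples tuples_nonempty[OF assms(1)] fin
    by (intro sum.cong refl, subst pmf_expectation_bind_pmf_of_set)
      (auto simp: divide_inverse_commute card_tuples sum_distrib_left mult_ac)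
  also have "(\<Sum>m=1..r. (\<Sum>s\<in>tuples m. measure_pmf.expectation (?f s) h) / n ^ m)
    = (\<Sum>m=1..r. (\<Sum>s\<in>tuples m. \<Sum>x\<in>labels (set s). pmf (\<mu> (set s)) x * h (set s, x)) / n ^ m)"
    by (intro sum.cong refl arg_cong2[where f = "(/)"] inner)
  finally show ?thesis .
qed

context
  fixes S :: "nat set" and x :: "nat \<Rightarrow> nat"
  assumes S: "S \<subseteq> {..<n}" and card: "card S \<le> r" and x: "x \<in> set_pmf (\<mu> S)"
begin

lemma card_insert_seed: "card (insert i S) \<le> r + 2"
  using card finite_S[OF S] by (auto simp: card_insert_if)

text \<open>\<open>cond_pmf\<close> is specified only for events that meet the support. By
  consistency this one has the probability of \<open>x\<close> under \<open>\<mu> S\<close>, which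
  is positive.\<close>

lemma cond_event_nonempty:
  assumes "i < n"
  shows "set_pmf (\<mu> (insert i S)) \<inter> {y. restrict y S = x} \<noteq> {}"
proof
  assume "set_pmf (\<mu> (insert i S)) \<inter> {y. restrict y S = x} = {}"
  then have "measure_pmf.prob (\<mu> (insert i S)) {y. restrict y S = x} = 0"
    by (simp add: measure_pmf_zero_iff)
  then have "pmf (\<mu> S) x = 0"
    using pmf_eq_prob_superset[OF S, of "insert i S" x] S assms card_insert_seed by auto
  then show False using x by (simp add: set_pmf_iff)
qed

lemma pmf_cond_label:
  assumes "i < n"
  shows "pmf (cond_label \<mu> S x i) a = cond1 \<mu> S x i a"
proof -
  let ?M = "\<mu> (insert i S)" and ?A = "{y. restrict y S = x}"
  have "emeasure (measure_pmf ?M) ?A \<noteq> 0"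
    using cond_event_nonempty[OF assms] by (rule emeasure_measure_pmf_not_zero)
  then have "pmf (cond_label \<mu> S x i) a = measure_pmf.prob ?M (?A \<inter> {y. y i = a}) / measure_pmf.prob ?M ?A"
    unfolding cond_label_def pmf_map cond_pmf.rep_eq[OF cond_event_nonempty[OF assms]]
    by (subst measure_uniform_measure) (auto simp: vimage_def measure_pmf.emeasure_eq_measure)
  also have "measure_pmf.prob ?M ?A = pmf (\<mu> S) x"
    using S assms card_insert_seed by (intro pmf_eq_prob_superset[OF S]) auto
  also have "?A \<inter> {y. y i = a} = {y. restrict y S = x \<and> y i = a}" by auto
  finally show ?thesis by (simp add: cond1_def marg1_def)
qed

lemma set_cond_label:
  assumes "i < n"
  shows "set_pmf (cond_label \<mu> S x i) \<subseteq> {..<k}"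
proof -
  have "insert i S \<subseteq> {..<n}" using S assms by auto
  then have "y i < k" if "y \<in> set_pmf (\<mu> (insert i S))" for y
    using support[of "insert i S"] card_insert_seed[of i] that by (auto simp: PiE_iff)
  then show ?thesis
    using cond_event_nonempty[OF assms] by (auto simp: cond_label_def)
qed

lemma cond_label_mem:
  assumes "i \<in> S"
  shows "cond_label \<mu> S x i = return_pmf (x i)"
proof -
  have "i < n" using assms S by auto
  have "set_pmf (cond_label \<mu> S x i) \<subseteq> {x i}"
    using cond_event_nonempty[OF \<open>i < n\<close>] assms by (auto simp: cond_label_def)
  then show ?thesis by (simp add: set_pmf_subset_singleton)
qed

text \<open>Given \<open>x\<close>, the label of a seed vertex is deterministic, so the seed is
  absorbed into the product and all vertices can be treated as independent alike.\<close>

lemma propagate_eq_Pi_pmf: "propagate n \<mu> S x = Pi_pmf {..<n} undefined (cond_label \<mu> S x)"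
proof -
  have "Pi_pmf {..<n} undefined (cond_label \<mu> S x)
    = Pi_pmf (S \<union> ({..<n} - S)) undefined (cond_label \<mu> S x)"
    using S by (simp add: Un_absorb1)
  also have "\<dots> = map_pmf (\<lambda>(f, g) i. if i \<in> S then f i else g i)
      (pair_pmf (Pi_pmf S undefined (cond_label \<mu> S x)) (Pi_pmf ({..<n} - S) undefined (cond_label \<mu> S x)))"
    using finite_S[OF S] by (intro Pi_pmf_union) auto
  also have "Pi_pmf S undefined (cond_label \<mu> S x) = return_pmf (\<lambda>i. if i \<in> S then x i else undefined)"
    using finite_S[OF S]
    by (subst Pi_pmf_cong[OF refl refl cond_label_mem]) simp_all
  finally show ?thesis
    by (simp add: propagate_def pair_return_pmf1 pmf.map_comp o_def cong: if_cong)
qed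

lemma finite_propagate: "finite (set_pmf (propagate n \<mu> S x))"
  unfolding propagate_eq_Pi_pmf
proof (subst set_Pi_pmf)
  show "finite (PiE_dflt {..<n} undefined (set_pmf \<circ> cond_label \<mu> S x))"
    using set_cond_label by (intro finite_PiE_dflt) (auto intro: finite_subset)
qed simp

text \<open>Both ends of a loop receive the same sampled label, so a loop is satisfied with its
  conditional local probability and loses nothing. Distinct ends are independent.\<close>

lemma propagate_satisfies:
  assumes ij: "i < n" "j < n"
  shows "measure_pmf.prob (propagate n \<mu> S x) {y. y j = \<pi> (y i)}
    = (if i = j then \<Sum>a<k. cond2 \<mu> S x i a j (\<pi> a) else \<Sum>a<k. cond1 \<mu> S x i a * cond1 \<mu> S x j (\<pi> a))"
proof -
  let ?M = "Pi_pmf {..<n} undefined (cond_label \<mu> S x)"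
  have "measure_pmf.prob ?M {y. y j = \<pi> (y i)}
    = (\<Sum>a<k. measure_pmf.prob ?M {y. y i = a \<and> y j = \<pi> (y i)})"
  proof (rule sum_prob_fibres[symmetric])
    fix y assume "y \<in> set_pmf ?M"
    then have "y i \<in> set_pmf (cond_label \<mu> S x i)"
      using ij by (auto simp: set_Pi_pmf PiE_dflt_def)
    then show "y i \<in> {..<k}" using set_cond_label[OF ij(1)] by auto
  qed simp
  also have "\<dots> = (\<Sum>a<k. measure_pmf.prob ?M {y. y i = a \<and> y j = \<pi> a})"
    by (intro sum.cong refl arg_cong2[where f = measure]) auto
  also have "\<dots> = (if i = j then \<Sum>a<k. cond2 \<mu> S x i a j (\<pi> a)
    else \<Sum>a<k. cond1 \<mu> S x i a * cond1 \<mu> S x j (\<pi> a))"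
  proof (cases "i = j")
    case True
    have "measure_pmf.prob ?M {y. y i = a \<and> y i = \<pi> a} = cond2 \<mu> S x i a i (\<pi> a)" for a
    proof (cases "\<pi> a = a")
      case True
      have "measure_pmf.prob ?M {y. y i = a} = pmf (map_pmf (\<lambda>y. y i) ?M) a"
        by (simp add: pmf_map vimage_def)
      also have "\<dots> = pmf (cond_label \<mu> S x i) a" using ij by (simp add: Pi_pmf_component)
      finally show ?thesis using True pmf_cond_label[OF ij(1), of a]
        by (simp add: cond1_def cond2_def marg2_diag[OF S])
    next
      case False
      then have empty: "{y. y i = a \<and> y i = \<pi> a} = {}" by auto
      show ?thesis unfolding empty using False by (simp add: cond2_def marg2_diag[OF S])
    qed
    then show ?thesis using True by simp
  next
    case False
    then show ?thesis using ij by (simp add: prob_two_coordinates pmf_cond_label)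
  qed
  finally show ?thesis unfolding propagate_eq_Pi_pmf .
qed

end

text \<open>Total probability over the seed labels, then consistency down to \<open>{i, j}\<close>.
  For impossible \<open>x\<close> the weighted term and \<open>marg2\<close> both vanish.\<close>

lemma sum_cond2_eq_local:
  assumes S: "S \<subseteq> {..<n}" and card: "card S \<le> r" and ij: "i < n" "j < n"
  shows "(\<Sum>x\<in>labels S. pmf (\<mu> S) x * (\<Sum>a<k. cond2 \<mu> S x i a j (\<pi> a)))
    = measure_pmf.prob (\<mu> {i, j}) {y. y j = \<pi> (y i)}"
proof -
  let ?T = "insert i (insert j S)"
  have T: "S \<subseteq> ?T" "{i, j} \<subseteq> ?T" "?T \<subseteq> {..<n}" "card ?T \<le> r + 2"
    using S card ij finite_S[OF S] by (auto simp: card_insert_if)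
  have "marg2 \<mu> S x i a j b = 0" if "pmf (\<mu> S) x = 0" for x a b
  proof -
    have "marg2 \<mu> S x i a j b \<le> pmf (\<mu> S) x"
      unfolding pmf_eq_prob_superset[OF S T(1,3,4), symmetric] marg2_def
      by (intro measure_pmf.finite_measure_mono) auto
    then show ?thesis using that marg2_nonneg[of \<mu> S x i a j b] by simp
  qed
  then have "(\<Sum>x\<in>labels S. pmf (\<mu> S) x * (\<Sum>a<k. cond2 \<mu> S x i a j (\<pi> a)))
    = (\<Sum>x\<in>labels S. \<Sum>a<k. marg2 \<mu> S x i a j (\<pi> a))"
    by (auto simp: cond2_def sum_distrib_left intro!: sum.cong)
  also have "\<dots> = (\<Sum>a<k. \<Sum>x\<in>labels S. marg2 \<mu> S x i a j (\<pi> a))"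
    by (rule sum.swap)
  also have "\<dots> = (\<Sum>a<k. measure_pmf.prob (\<mu> ?T) {y. y i = a \<and> y j = \<pi> a})"
    unfolding marg2_def using prob_fibres_labels[OF S T(1,3,4)] by simp
  also have "\<dots> = (\<Sum>a<k. measure_pmf.prob (\<mu> ?T) {y. y i = a \<and> y j = \<pi> (y i)})"
    by (intro sum.cong refl arg_cong2[where f = measure]) auto
  also have "\<dots> = measure_pmf.prob (\<mu> ?T) {y. y j = \<pi> (y i)}"
    using support[OF T(3,4)] by (intro sum_prob_fibres) (auto simp: PiE_iff)
  also have "\<dots> = measure_pmf.prob (\<mu> {i, j}) {y. y j = \<pi> (y i)}"
    by (rule consistent[OF T(2-4)]) simp
  finally show ?thesis .
qed

end

section \<open>The expected loss over seeds and constraints\<close>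

locale regular_ug_lasserre = lasserre n k r \<mu> v
  for n k r :: nat and \<mu> :: local_dists and v :: lasserre_vectors +
  fixes I :: ug and D :: real
  assumes I: "ug_instance n k I"
    and D: "\<And>i. i < n \<Longrightarrow> weighted_degree n I i = D"
    and r_pos: "r > 0"
begin

lemmas vertices_pos = n_pos[OF I D]

lemma finite_I: "finite (set_pmf I)"
  by (rule finite_ug_instance[OF I])

lemma integrable_I: "integrable (measure_pmf I) (f :: _ \<Rightarrow> real)"
  by (rule integrable_measure_pmf_finite[OF finite_I])

lemma integrable_seed: "integrable (measure_pmf (seed n r \<mu>)) (f :: _ \<Rightarrow> real)"
  by (rule integrable_measure_pmf_finite[OF finite_seed[OF vertices_pos r_pos]])

lemma constraint_cases:
  assumes "e \<in> set_pmf I"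
  obtains i j \<pi> where "e = (i, j, \<pi>)" "i < n" "j < n" "\<pi> permutes {..<k}"
  using assms I by (cases e) (auto simp: ug_instance_def)

definition constraint_loss :: "nat set \<Rightarrow> (nat \<Rightarrow> nat) \<Rightarrow> nat \<times> nat \<times> (nat \<Rightarrow> nat) \<Rightarrow> real" where
  "constraint_loss S x = (\<lambda>(i, j, \<pi>). (\<Sum>a<k. cond2 \<mu> S x i a j (\<pi> a))
     - measure_pmf.prob (propagate n \<mu> S x) {y. y j = \<pi> (y i)})"

definition loss :: "nat set \<times> (nat \<Rightarrow> nat) \<Rightarrow> real" where
  "loss = (\<lambda>(S, x). measure_pmf.expectation I (constraint_loss S x))"

definition total_gain :: "nat set \<times> (nat \<Rightarrow> nat) \<Rightarrow> real" where
  "total_gain = (\<lambda>(S, x). \<Sum>i<n. \<Sum>j<n. cgain S x i j)"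

lemma expected_value_eq:
  "measure_pmf.expectation (propagation_sampling n r \<mu>) (ug_value I)
    = measure_pmf.expectation (seed n r \<mu>) (\<lambda>(S, x). measure_pmf.expectation I
        (\<lambda>(i, j, \<pi>). measure_pmf.prob (propagate n \<mu> S x) {y. y j = \<pi> (y i)}))"
proof -
  have fin: "finite (set_pmf (case z of (S, x) \<Rightarrow> propagate n \<mu> S x))"
    if "z \<in> set_pmf (seed n r \<mu>)" for z
    using that seed_support[OF vertices_pos r_pos] finite_propagate by (cases z) auto
  have "measure_pmf.expectation (propagation_sampling n r \<mu>) (ug_value I)
    = measure_pmf.expectation (seed n r \<mu>)
        (\<lambda>z. measure_pmf.expectation (case z of (S, x) \<Rightarrow> propagate n \<mu> S x) (ug_value I))"
  proof -
    have "measure_pmf.expectation (propagation_sampling n r \<mu>) (ug_value I)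
      = (\<Sum>z\<in>set_pmf (seed n r \<mu>). pmf (seed n r \<mu>) z *\<^sub>R
          measure_pmf.expectation (case z of (S, x) \<Rightarrow> propagate n \<mu> S x) (ug_value I))"
      unfolding propagation_sampling_eq_bind
      by (rule pmf_expectation_bind[OF finite_seed[OF vertices_pos r_pos] fin subset_refl])
    also have "\<dots> = measure_pmf.expectation (seed n r \<mu>)
        (\<lambda>z. measure_pmf.expectation (case z of (S, x) \<Rightarrow> propagate n \<mu> S x) (ug_value I))"
      by (rule integral_measure_pmf[OF finite_seed[OF vertices_pos r_pos], symmetric])
    finally show ?thesis .
  qed
  also have "\<dots> = measure_pmf.expectation (seed n r \<mu>) (\<lambda>(S, x). measure_pmf.expectation I
        (\<lambda>(i, j, \<pi>). measure_pmf.prob (propagate n \<mu> S x) {y. y j = \<pi> (y i)}))"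
  proof (intro integral_cong_AE AE_pmfI)
    fix z assume z: "z \<in> set_pmf (seed n r \<mu>)"
    obtain S x where [simp]: "z = (S, x)" by (cases z)
    let ?P = "propagate n \<mu> S x"
    have fP: "finite (set_pmf ?P)" using fin[OF z] by simp
    have "ug_value I y = measure_pmf.expectation I (\<lambda>(i, j, \<pi>). indicator {y. y j = \<pi> (y i)} y)" for y
    proof -
      have "ug_value I y = measure_pmf.expectation I (indicator {(i, j, \<pi>). y j = \<pi> (y i)})"
        by (simp add: ug_value_def)
      also have "\<dots> = measure_pmf.expectation I (\<lambda>(i, j, \<pi>). indicator {y. y j = \<pi> (y i)} y)"
        by (intro Bochner_Integration.integral_cong refl) (simp add: indicator_def case_prod_unfold)
      finally show ?thesis .
    qed
    then have "measure_pmf.expectation ?P (ug_value I) = measure_pmf.expectation ?P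
      (\<lambda>y. measure_pmf.expectation I (\<lambda>e. case e of (i, j, \<pi>) \<Rightarrow> indicator {y. y j = \<pi> (y i)} y))"
      by presburger
    also have "\<dots> = measure_pmf.expectation I (\<lambda>e. measure_pmf.expectation ?P
        (\<lambda>y. case e of (i, j, \<pi>) \<Rightarrow> indicator {y. y j = \<pi> (y i)} y))"
      by (rule expectation_swap[OF fP finite_I])
    also have "\<dots> = measure_pmf.expectation I (\<lambda>(i, j, \<pi>). measure_pmf.prob ?P {y. y j = \<pi> (y i)})"
      by (intro Bochner_Integration.integral_cong refl) (simp add: case_prod_unfold)
    finally show "measure_pmf.expectation (case z of (S, x) \<Rightarrow> propagate n \<mu> S x) (ug_value I)
      = (case z of (S, x) \<Rightarrow> measure_pmf.expectation I
        (\<lambda>(i, j, \<pi>). measure_pmf.prob (propagate n \<mu> S x) {y. y j = \<pi> (y i)}))" by simp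
  qed auto
  finally show ?thesis .
qed

text \<open>For every fixed seed, averaging the conditional probabilities over its labels restores
  the local ones. The objective can therefore be compared with the output seed by seed.\<close>

lemma objective_eq:
  "lasserre_objective I \<mu> = measure_pmf.expectation (seed n r \<mu>) (\<lambda>(S, x).
    measure_pmf.expectation I (\<lambda>(i, j, \<pi>). \<Sum>a<k. cond2 \<mu> S x i a j (\<pi> a)))"
proof -
  have "lasserre_objective I \<mu> = measure_pmf.expectation I (\<lambda>e. measure_pmf.expectation (seed n r \<mu>)
    (\<lambda>z. case z of (S, x) \<Rightarrow> case e of (i, j, \<pi>) \<Rightarrow> \<Sum>a<k. cond2 \<mu> S x i a j (\<pi> a)))"
    unfolding lasserre_objective_def
  proof (intro integral_cong_AE AE_pmfI)
    fix e assume "e \<in> set_pmf I"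
    then obtain i j \<pi> where e: "e = (i, j, \<pi>)" "i < n" "j < n" by (rule constraint_cases)
    let ?c = "measure_pmf.prob (\<mu> {i, j}) {y. y j = \<pi> (y i)}"
    have "measure_pmf.expectation (seed n r \<mu>) (\<lambda>(S, x). \<Sum>a<k. cond2 \<mu> S x i a j (\<pi> a))
      = (\<Sum>m=1..r. (\<Sum>s\<in>tuples m. \<Sum>x\<in>labels (set s).
          pmf (\<mu> (set s)) x * (\<Sum>a<k. cond2 \<mu> (set s) x i a j (\<pi> a))) / n ^ m) / r"
      by (simp only: seed_expectation[OF vertices_pos r_pos] prod.case)
    also have "\<dots> = (\<Sum>m=1..r. (\<Sum>s\<in>tuples m. ?c) / n ^ m) / r"
    proof (intro arg_cong2[where f = "(/)"] sum.cong refl)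
      fix m s assume "m \<in> {1..r}" "s \<in> tuples m"
      then have "set s \<subseteq> {..<n}" "card (set s) \<le> r" using tuples_set[of s m] by auto
      then show "(\<Sum>x\<in>labels (set s). pmf (\<mu> (set s)) x * (\<Sum>a<k. cond2 \<mu> (set s) x i a j (\<pi> a))) = ?c"
        by (rule sum_cond2_eq_local) (fact e)+
    qed
    also have "\<dots> = ?c"
      using vertices_pos r_pos by (simp add: card_tuples)
    finally show "(case e of (i, j, \<pi>) \<Rightarrow> measure_pmf.prob (\<mu> {i, j}) {y. y j = \<pi> (y i)})
      = measure_pmf.expectation (seed n r \<mu>)
        (\<lambda>z. case z of (S, x) \<Rightarrow> case e of (i, j, \<pi>) \<Rightarrow> \<Sum>a<k. cond2 \<mu> S x i a j (\<pi> a))"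
      by (simp add: e)
  qed auto
  also have "\<dots> = measure_pmf.expectation (seed n r \<mu>) (\<lambda>z. measure_pmf.expectation I
    (\<lambda>e. case z of (S, x) \<Rightarrow> case e of (i, j, \<pi>) \<Rightarrow> \<Sum>a<k. cond2 \<mu> S x i a j (\<pi> a)))"
    by (rule expectation_swap[OF finite_I finite_seed[OF vertices_pos r_pos]])
  finally show ?thesis by (simp add: case_prod_unfold)
qed

lemma expected_loss_eq:
  "lasserre_objective I \<mu> - measure_pmf.expectation (propagation_sampling n r \<mu>) (ug_value I)
    = measure_pmf.expectation (seed n r \<mu>) loss"
  unfolding expected_value_eq objective_eq
    Bochner_Integration.integral_diff[OF integrable_seed integrable_seed, symmetric]
  by (intro Bochner_Integration.integral_cong refl)
    (auto simp: loss_def constraint_loss_def case_prod_unfold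
      Bochner_Integration.integral_diff[OF integrable_I integrable_I])

text \<open>Jensen over the constraints moves the square inside, where \<open>corr\<close> bounds
  it. The second claim makes the square root of the gain meaningful when expectations over seeds are
  taken.\<close>

lemma loss_squared_le:
  assumes S: "S \<subseteq> {..<n}" and card: "card S \<le> r" and x: "x \<in> set_pmf (\<mu> S)" and \<tau>: "0 \<le> \<tau>"
  shows "(loss (S, x))\<^sup>2 \<le> 2 * \<tau> +
    2 * sqrt (threshold_rank \<tau> (normalized_adjacency n I) * (total_gain (S, x) / n\<^sup>2))"
    and "0 \<le> total_gain (S, x)"
proof -
  obtain N U U0 where "pairwise_distribution n k N (cond1 \<mu> S x) (cond2 \<mu> S x) U U0"
    using conditional_pairwise_distribution[OF S card x] by blast
  then interpret pairwise_distribution n k N "cond1 \<mu> S x" "cond2 \<mu> S x" U U0 .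
  let ?R = "threshold_rank \<tau> (normalized_adjacency n I)"
  show "0 \<le> total_gain (S, x)"
    unfolding total_gain_def prod.case by (intro sum_nonneg gain_nonneg) auto
  have "(loss (S, x))\<^sup>2 \<le> measure_pmf.expectation I (\<lambda>e. (constraint_loss S x e)\<^sup>2)"
    unfolding loss_def using expectation_square_le[OF finite_I] by simp
  also have "\<dots> \<le> measure_pmf.expectation I (\<lambda>(i, j, \<pi>). corr i j)"
  proof (rule integral_mono_AE[OF integrable_I integrable_I], rule AE_pmfI)
    fix e assume "e \<in> set_pmf I"
    then obtain i j \<pi> where e: "e = (i, j, \<pi>)" "i < n" "j < n" "\<pi> permutes {..<k}"
      by (rule constraint_cases)
    show "(constraint_loss S x e)\<^sup>2 \<le> (case e of (i, j, \<pi>) \<Rightarrow> corr i j)"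
    proof (cases "i = j")
      case True
      then show ?thesis
        using e propagate_satisfies[OF S card x e(2,3), of \<pi>] corr_nonneg[of i j]
        by (simp add: constraint_loss_def)
    next
      case False
      then have "constraint_loss S x e = (\<Sum>a<k. cov i a j (\<pi> a))"
        using e propagate_satisfies[OF S card x e(2,3), of \<pi>]
        by (simp add: constraint_loss_def cov_def sum_subtractf)
      then show ?thesis using loss_squared_le_corr[OF e(2-4)] e(1) by simp
    qed
  qed
  also have "\<dots> \<le> 2 * \<tau> + 2 * sqrt (?R * ((\<Sum>i<n. \<Sum>j<n. corr i j) / n\<^sup>2))"
    by (rule edge_average_le_global_average[OF I D corr_gram corr_nonneg corr_le_1 \<tau>])
  also have "\<dots> \<le> 2 * \<tau> + 2 * sqrt (?R * (total_gain (S, x) / n\<^sup>2))"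
  proof -
    have "(\<Sum>i<n. \<Sum>j<n. corr i j) \<le> (\<Sum>i<n. \<Sum>j<n. (gain i j + gain j i) / 2)"
      by (intro sum_mono corr_le_gain) auto
    also have "\<dots> = ((\<Sum>i<n. \<Sum>j<n. gain i j) + (\<Sum>i<n. \<Sum>j<n. gain j i)) / 2"
      by (simp add: sum.distrib sum_divide_distrib add_divide_distrib)
    also have "(\<Sum>i<n. \<Sum>j<n. gain j i) = (\<Sum>i<n. \<Sum>j<n. gain i j)"
      by (rule sum.swap)
    finally have "(\<Sum>i<n. \<Sum>j<n. corr i j) \<le> total_gain (S, x)"
      by (simp add: total_gain_def)
    then show ?thesis
      by (intro add_left_mono mult_left_mono real_sqrt_le_mono divide_right_mono) auto
  qed
  finally show "(loss (S, x))\<^sup>2 \<le> 2 * \<tau> + 2 * sqrt (?R * (total_gain (S, x) / n\<^sup>2))" .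
qed

text \<open>Telescoping leaves \<open>n\<close> times a difference of two numbers in [0, n], and the
  uniform choice of \<open>m\<close> divides it by \<open>r\<close>.\<close>

lemma expected_total_gain_le:
  "measure_pmf.expectation (seed n r \<mu>) total_gain \<le> n\<^sup>2 / r"
proof -
  have "measure_pmf.expectation (seed n r \<mu>) total_gain
    = (\<Sum>m=1..r. (\<Sum>s\<in>tuples m. \<Sum>x\<in>labels (set s).
        pmf (\<mu> (set s)) x * (\<Sum>i<n. \<Sum>j<n. cgain (set s) x i j)) / n ^ m) / r"
    by (simp only: seed_expectation[OF vertices_pos r_pos] total_gain_def prod.case)
  also have "\<dots> = (\<Sum>m=1..r. n * (mean_potential (Suc m) - mean_potential m)) / r"
    by (intro arg_cong2[where f = "(/)"] sum.cong refl mean_potential_step vertices_pos) auto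
  also have "(\<Sum>m=1..r. n * (mean_potential (Suc m) - mean_potential m))
    = n * (mean_potential (Suc r) - mean_potential 1)"
    using r_pos by (simp add: sum_Suc_diff flip: sum_distrib_left)
  also have "\<dots> \<le> n * real n"
    using mean_potential_bounds[OF vertices_pos, of "Suc r"] mean_potential_bounds[OF vertices_pos, of 1]
    by (intro mult_left_mono) auto
  finally show ?thesis using r_pos by (simp add: power2_eq_square divide_right_mono)
qed

text \<open>Jensen over the seeds is used twice: for the square of the loss, and for the concave
  square root of the gain.\<close>

lemma expected_loss_squared_le:
  assumes \<tau>: "0 \<le> \<tau>"
  shows "(measure_pmf.expectation (seed n r \<mu>) loss)\<^sup>2
    \<le> 2 * \<tau> + 2 * sqrt (threshold_rank \<tau> (normalized_adjacency n I) / r)"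
proof -
  let ?E = "measure_pmf.expectation (seed n r \<mu>)"
  define R where "R = real (threshold_rank \<tau> (normalized_adjacency n I))"
  define g where "g z = R * (total_gain z / n\<^sup>2)" for z
  have R0: "0 \<le> R" by (simp add: R_def)
  have bound: "(loss z)\<^sup>2 \<le> 2 * \<tau> + 2 * sqrt (g z)" "0 \<le> g z" if "z \<in> set_pmf (seed n r \<mu>)" for z
    using seed_support[OF vertices_pos r_pos, of "fst z" "snd z"] that R0
      loss_squared_le[of "fst z" "snd z", OF _ _ _ \<tau>]
    by (auto simp: g_def R_def)
  have "?E (\<lambda>z. sqrt (g z)) \<le> sqrt (?E g)"
  proof (rule real_le_rsqrt)
    have "(?E (\<lambda>z. sqrt (g z)))\<^sup>2 \<le> ?E (\<lambda>z. (sqrt (g z))\<^sup>2)"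
      by (rule expectation_square_le[OF finite_seed[OF vertices_pos r_pos]])
    also have "\<dots> = ?E g"
      using bound(2) by (intro integral_cong_AE AE_pmfI) auto
    finally show "(?E (\<lambda>z. sqrt (g z)))\<^sup>2 \<le> ?E g" .
  qed
  also have "?E g = R * (?E total_gain / n\<^sup>2)"
    by (simp add: g_def[abs_def])
  also have "\<dots> \<le> R * ((n\<^sup>2 / r) / n\<^sup>2)"
    using expected_total_gain_le R0 by (intro mult_left_mono divide_right_mono) auto
  also have "\<dots> = R / r" using vertices_pos by simp
  finally have sqrt_le: "?E (\<lambda>z. sqrt (g z)) \<le> sqrt (R / r)" by simp
  have "(?E loss)\<^sup>2 \<le> ?E (\<lambda>z. (loss z)\<^sup>2)"
    by (rule expectation_square_le[OF finite_seed[OF vertices_pos r_pos]])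
  also have "\<dots> \<le> ?E (\<lambda>z. 2 * \<tau> + 2 * sqrt (g z))"
    using bound(1) by (intro integral_mono_AE integrable_seed AE_pmfI)
  also have "\<dots> = 2 * \<tau> + 2 * ?E (\<lambda>z. sqrt (g z))"
    by (simp add: integrable_seed)
  finally show ?thesis using sqrt_le by (simp add: R_def)
qed

end

section \<open>The optimal value and the choice of the constants\<close>

lemma lasserre_solution_alphabet_pos:
  assumes "lasserre_solution n k r \<mu> v" and "n > 0"
  shows "k > 0"
proof -
  interpret lasserre n k r \<mu> v using assms(1) by unfold_locales
  obtain x where "x \<in> set_pmf (\<mu> {0})" using set_pmf_not_empty by fast
  then have "x \<in> {0} \<rightarrow>\<^sub>E {..<k}" using support[of "{0}"] assms(2) by auto
  then show ?thesis by (auto simp: PiE_iff)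
qed

lemma lasserre_objective_le_1: "lasserre_objective I \<mu> \<le> 1"
  unfolding lasserre_objective_def
  by (rule measure_pmf.integral_le_const) (auto intro!: measure_pmf.integrable_const_bound[where B = 1])

lemma optimal_lasserre_value:
  assumes "optimal_lasserre_solution n k r I \<mu> v"
  shows "lasserre_value n k r I = lasserre_objective I \<mu>"
  unfolding lasserre_value_def
  using assms by (intro cSup_eq_maximum) (auto simp: optimal_lasserre_solution_def)

theorem theorem5p9:
  shows "\<exists>C c d :: real. C > 0 \<and> c > 0 \<and> d > 0 \<and>
    (\<forall>(n :: nat) (k :: nat) (r :: nat) (I :: ug) (\<epsilon> :: real) (\<sigma> :: real)
       (\<mu> :: local_dists) (v :: lasserre_vectors).
       ug_instance n k I \<longrightarrow>
       regular_constraint_graph n I \<longrightarrow>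
       \<epsilon> > 0 \<longrightarrow>
       real r \<ge> C * real k * real (threshold_rank (c * \<epsilon> ^ 4) (normalized_adjacency n I))
                  / \<epsilon> powr d \<longrightarrow>
       lasserre_value n k r I = \<sigma> \<longrightarrow>
       optimal_lasserre_solution n k r I \<mu> v \<longrightarrow>
       measure_pmf.expectation (propagation_sampling n r \<mu>) (ug_value I) \<ge> \<sigma> - \<epsilon>)"
\<comment> \<open>Each of the two terms of the loss bound may use \<open>\<epsilon>^2 / 2\<close>.
  For \<open>\<epsilon> < 1\<close>, \<open>c = 1/4\<close> gives
  \<open>2 * \<tau> = \<epsilon>^4 / 2 \<le> \<epsilon>^2 / 2\<close>, while \<open>C = 16\<close>
  and \<open>d = 4\<close> give \<open>R / r \<le> (\<epsilon>^2 / 4)^2\<close>.\<close>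
proof (rule exI[of _ 16], rule exI[of _ "1 / 4"], rule exI[of _ 4], intro conjI allI impI)
  fix n k r :: nat and I :: ug and \<epsilon> \<sigma> :: real and \<mu> :: local_dists and v :: lasserre_vectors
  assume I: "ug_instance n k I" and reg: "regular_constraint_graph n I" and \<epsilon>: "\<epsilon> > 0"
    and r: "real r \<ge> 16 * real k * real (threshold_rank (1 / 4 * \<epsilon> ^ 4) (normalized_adjacency n I)) / \<epsilon> powr 4"
    and \<sigma>: "lasserre_value n k r I = \<sigma>"
    and opt: "optimal_lasserre_solution n k r I \<mu> v"
  let ?PS = "measure_pmf.expectation (propagation_sampling n r \<mu>) (ug_value I)"
  have obj: "\<sigma> = lasserre_objective I \<mu>" using optimal_lasserre_value[OF opt] \<sigma> by simp
  obtain D where D: "\<And>i. i < n \<Longrightarrow> weighted_degree n I i = D"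
    using reg by (auto simp: regular_constraint_graph_def)
  have sol: "lasserre_solution n k r \<mu> v" using opt by (simp add: optimal_lasserre_solution_def)
  have n: "n > 0" by (rule n_pos[OF I D])
  have k: "k > 0" by (rule lasserre_solution_alphabet_pos[OF sol n])
  show "?PS \<ge> \<sigma> - \<epsilon>"
  proof (cases "\<epsilon> \<ge> 1")
    \<comment> \<open>No value exceeds 1, so nothing is to be shown beyond nonnegativity. In the
      other case \<open>\<epsilon> < 1\<close> yields \<open>\<epsilon>^4 \<le> \<epsilon>^2\<close>
      and \<open>\<tau> < 1\<close>.\<close>
    case True
    have "?PS \<ge> 0" by (rule Bochner_Integration.integral_nonneg) (simp add: ug_value_def)
    then show ?thesis using lasserre_objective_le_1[of I \<mu>] obj True by simp
  next
    case False
    define \<tau> where "\<tau> = 1 / 4 * \<epsilon> ^ 4"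
    define R where "R = threshold_rank \<tau> (normalized_adjacency n I)"
    have \<epsilon>4: "\<epsilon> ^ 4 \<le> \<epsilon>\<^sup>2" using \<epsilon> False by (intro power_decreasing) auto
    have \<epsilon>2: "\<epsilon>\<^sup>2 \<le> 1" using \<epsilon> False by (intro power_le_one) auto
    have \<tau>: "0 \<le> \<tau>" "\<tau> < 1" "2 * \<tau> \<le> \<epsilon>\<^sup>2 / 2" using \<epsilon> \<epsilon>4 \<epsilon>2 by (auto simp: \<tau>_def)
    \<comment> \<open>A positive rank makes the lower bound on \<open>r\<close> positive; for
      \<open>r = 0\<close> the range of \<open>m\<close> would be empty and the sampling
      unspecified.\<close>
    have R: "R > 0" unfolding R_def by (rule threshold_rank_pos[OF I D \<tau>(1,2)])
    have "16 * real R / \<epsilon> ^ 4 \<le> 16 * real k * real R / \<epsilon> ^ 4"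
      using mult_right_mono[of 1 "real k" "real R"] k \<epsilon> by (intro divide_right_mono) auto
    also have "\<dots> \<le> r" using r \<epsilon> by (simp add: R_def \<tau>_def powr_numeral)
    finally have rR: "16 * real R / \<epsilon> ^ 4 \<le> r" .
    have "0 < 16 * real R / \<epsilon> ^ 4" using R \<epsilon> by simp
    then have r0: "r > 0" using rR by linarith
    interpret regular_ug_lasserre n k r \<mu> v I D
      using I D sol r0 by unfold_locales
    have "R / r \<le> (\<epsilon>\<^sup>2 / 4)\<^sup>2"
    proof -
      have "16 * R \<le> r * \<epsilon> ^ 4" using rR \<epsilon> by (simp add: pos_divide_le_eq)
      then have "R / r \<le> \<epsilon> ^ 4 / 16" using r0 by (simp add: pos_divide_le_eq mult.commute)
      also have "\<epsilon> ^ 4 / 16 = (\<epsilon>\<^sup>2 / 4)\<^sup>2" by (simp add: power_divide flip: power_mult)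
      finally show ?thesis .
    qed
    then have "sqrt (R / r) \<le> \<epsilon>\<^sup>2 / 4" by (rule real_le_lsqrt[rotated]) simp
    moreover have "(\<sigma> - ?PS)\<^sup>2 \<le> 2 * \<tau> + 2 * sqrt (R / r)"
      using expected_loss_squared_le[OF \<tau>(1)] expected_loss_eq by (simp add: obj R_def)
    ultimately have "(\<sigma> - ?PS)\<^sup>2 \<le> \<epsilon>\<^sup>2" using \<tau>(3) by simp
    then have "\<sigma> - ?PS \<le> \<epsilon>" by (rule power2_le_imp_le) (use \<epsilon> in simp)
    then show ?thesis by simp
  qed
qed auto

end
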